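(* Assume (A1). Fix $\epsilon>0$. Call a vertex $v$ of the split tree $T^n$ good if $\mu^{-1}\ln n-\ln^{0.5+\epsilon}n\le d(v)\le \mu^{-1}\ln n+\ln^{0.5+\epsilon}n$, and bad otherwise. Then for every constant $k>0$ there is a constant $C$ such that for all $n\ge 2$ the expected number of bad vertices of $T^n$ is at most $C\,n/\ln^k n$.
   Context: Split trees. Fix integers $b\ge 2$, $s\ge 1$, $s_0,s_1\ge 0$ with $s_0\le s$ and $bs_1\le s+1-s_0$, and a random vector $\mathcal V=(V_1,\dots,V_b)$ with $V_i\ge 0$, $\sum_i V_i=1$, whose components are identically distributed; let $V$ be a random variable with this common law. Let $S_b$ be the infinite rooted tree in which every vertex has $b$ children labelled $1,\dots,b$, and attach to each vertex $v$ an independent copy $\mathcal V_v$ of $\mathcal V$. Balls are inserted one at a time at the root. For a vertex $v$, $n_v$ is the number of balls in the subtree of $S_b$ rooted at $v$ and $C_v$ the number held by $v$ itself; $v$ is a leaf if $C_v=n_v>0$. A ball arriving at $v$ is handled as follows: if $n_v=0$, or $v$ is a leaf with $C_v<s$, the ball is placed at $v$; if $n_v>0$ and $v$ is not a leaf, the ball moves to the $i$-th child with probability equal to the $i$-th component of $\mathcal V_v$ and is handled there by the same rules; if $v$ is a leaf with $C_v=s$, then of the $s+1$ balls, $s_0$ uniformly chosen balls stay at $v$, $s_1$ uniformly chosen balls are sent to each of the $b$ children, and each of the remaining $s+1-s_0-bs_1$ balls is sent to a child chosen independently according to $\mathcal V_v$; balls sent to a child are handled there by the same rules. After $n$ balls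 have been inserted, the split tree $T^n$ consists of all vertices $v$ of $S_b$ with $n_v>0$. $d(v)$ is the depth (distance to the root) of $v$. Set $\mu:=b\,\mathbf E(-V\ln V)$. Assumption (A1): $\mathbf P(V=0)=\mathbf P(V=1)=0$ and $-\ln V$ has a non-lattice distribution. *)

theory Defs
  imports "HOL-Probability.Probability" "HOL-Library.Sublist"
begin

(* Vertices of S_b are words over {0..<b} (type nat list); the root is [].
   A configuration C :: nat list => nat gives C_v, the number of balls held by v. *)

definition nsub :: "(nat list \<Rightarrow> nat) \<Rightarrow> nat list \<Rightarrow> nat" where
  "nsub C v = (\<Sum>w \<in> {w. prefix v w \<and> C w \<noteq> 0}. C w)"

definition is_leaf :: "(nat list \<Rightarrow> nat) \<Rightarrow> nat list \<Rightarrow> bool" where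
  "is_leaf C v \<longleftrightarrow> C v = nsub C v \<and> nsub C v > 0"

definition child_pmf :: "nat \<Rightarrow> (nat \<Rightarrow> real) \<Rightarrow> nat pmf" where
  "child_pmf b w =
     (if (\<forall>i<b. 0 \<le> w i) \<and> (\<Sum>i<b. w i) = 1
      then embed_pmf (\<lambda>i. if i < b then w i else 0) else return_pmf 0)"

(* Insert a work-list of balls; each entry is the vertex at which that ball currently arrives.
   \<omega> v is the split vector attached to the vertex v. *)
partial_function (spmf) ins_balls ::
  "nat \<Rightarrow> nat \<Rightarrow> nat \<Rightarrow> nat \<Rightarrow> (nat list \<Rightarrow> nat \<Rightarrow> real) \<Rightarrow> nat list list
     \<Rightarrow> (nat list \<Rightarrow> nat) \<Rightarrow> (nat list \<Rightarrow> nat) spmf" where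
  "ins_balls b s s0 s1 \<omega> vs C =
    (case vs of
       [] \<Rightarrow> return_spmf C
     | v # rest \<Rightarrow>
        (if nsub C v = 0 \<or> (is_leaf C v \<and> C v < s)
         then ins_balls b s s0 s1 \<omega> rest (C(v := Suc (C v)))
         else if \<not> is_leaf C v
         then bind_spmf (spmf_of_pmf (child_pmf b (\<omega> v)))
                (\<lambda>i. ins_balls b s s0 s1 \<omega> ((v @ [i]) # rest) C)
         else bind_spmf (spmf_of_pmf (replicate_pmf (s + 1 - s0 - b * s1) (child_pmf b (\<omega> v))))
                (\<lambda>ds. ins_balls b s s0 s1 \<omega>
                        (map (\<lambda>i. v @ [i]) (concat (map (\<lambda>i. replicate s1 i) [0..<b]) @ ds) @ rest)
                        (C(v := s0)))))"

primrec split_config ::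
  "nat \<Rightarrow> nat \<Rightarrow> nat \<Rightarrow> nat \<Rightarrow> (nat list \<Rightarrow> nat \<Rightarrow> real) \<Rightarrow> nat \<Rightarrow> (nat list \<Rightarrow> nat) spmf" where
  "split_config b s s0 s1 \<omega> 0 = return_spmf (\<lambda>_. 0)"
| "split_config b s s0 s1 \<omega> (Suc n) =
     bind_spmf (split_config b s s0 s1 \<omega> n) (ins_balls b s s0 s1 \<omega> [[]])"

definition tree_vertices :: "(nat list \<Rightarrow> nat) \<Rightarrow> nat list set" where
  "tree_vertices C = {v. nsub C v > 0}"

definition good_depth :: "real \<Rightarrow> real \<Rightarrow> nat \<Rightarrow> nat \<Rightarrow> bool" where
  "good_depth \<mu> \<epsilon> n d \<longleftrightarrow>
     ln (real n) / \<mu> - ln (real n) powr (1/2 + \<epsilon>) \<le> real d \<and>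
     real d \<le> ln (real n) / \<mu> + ln (real n) powr (1/2 + \<epsilon>)"

definition bad_count :: "real \<Rightarrow> real \<Rightarrow> nat \<Rightarrow> (nat list \<Rightarrow> nat) \<Rightarrow> nat" where
  "bad_count \<mu> \<epsilon> n C = card {v \<in> tree_vertices C. \<not> good_depth \<mu> \<epsilon> n (length v)}"

definition lattice_rv :: "'a measure \<Rightarrow> ('a \<Rightarrow> real) \<Rightarrow> bool" where
  "lattice_rv M X \<longleftrightarrow> (\<exists>a d. d > 0 \<and> (AE x in M. \<exists>m::int. X x = a + d * of_int m))"

end

theory Submission
  imports Defs
begin

text \<open>Fix the split vectors and a vertex \<open>t\<close> reached by a random walk from the root with
  probability \<open>L\<close>. If a ball at \<open>w\<close> carries the weight \<open>1 + z \<cdot> P(w \<leadsto> t)\<close>, then the product of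
  all weights, corrected for the \<open>s1\<close> balls forced into each child of a split vertex, is a
  martingale. Hence \<open>P(n_t \<ge> s1 + 2) \<le> (1 + z L)^n / (1 + z)^2\<close>, and \<open>z = 1 / (n L)\<close> gives the bound
  \<open>e (n L)^\<theta>\<close> for every \<open>0 \<le> \<theta> \<le> 2\<close>. Every vertex of depth at least two has a grandparent with
  \<open>n_t \<ge> s1 + 2\<close>, so the expected number of vertices at depth \<open>d\<close> is at most
  \<open>b^2 e n^\<theta> m(\<theta>)^(d - 2)\<close>, where \<open>m(\<theta>) = b E V^\<theta> = 1 - \<mu> (\<theta> - 1) + O((\<theta> - 1)^2)\<close> near \<open>1\<close>.
  Taking \<open>\<theta> = 1 - \<delta>\<close> at small and \<open>\<theta> = 1 + \<delta>\<close> at large depths, with \<open>\<delta>\<close> of order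
  \<open>(ln n)^(\<epsilon>' - 1/2)\<close>, makes the bad depths contribute \<open>n exp(- \<kappa> (ln n)^(2 \<epsilon>'))\<close> up to a factor
  \<open>ln n\<close>.\<close>

section \<open>The insertion process\<close>

text \<open>The obstacle is the \<open>s1\<close> balls sent to each child without choice: the
  number of balls reaching \<open>t\<close> is not binomial, and a ball may reach \<open>t\<close>
  by forced steps. Weighting all balls at once allows each split to be corrected by an explicit
  factor. Along the path to \<open>t\<close> these factors telescope, so all forced steps together
  cost at most (1 + z)^s1; this is why s1 + 2 balls leave the exponent 2. An exponent above 1 is
  essential: since b E V = 1, a first-moment bound (\<theta> = 1) does not decay with the depth, and
  the large depths need \<theta> > 1. A parent of a vertex is only known to hold s + 1 balls, which
  can be fewer than s1 + 2 (for example s = s1 = 1, b = 2, s0 = 0); hence the step to the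
  grandparent, where a sibling subtree supplies \<open>s1\<close> more.\<close>

lemma admissible_nn_integral_spmf_le:
  "ccpo.admissible lub_spmf (ord_spmf (=)) (\<lambda>p. (\<integral>\<^sup>+ x. f x \<partial>measure_spmf p) \<le> c)"
proof (rule ccpo.admissibleI)
  fix Y :: "'a spmf set"
  assume chain: "Complete_Partial_Order.chain (ord_spmf (=)) Y" and Y: "Y \<noteq> {}"
    and le: "\<forall>p\<in>Y. (\<integral>\<^sup>+ x. f x \<partial>measure_spmf p) \<le> c"
  \<comment> \<open>A chain need not be a sequence, but the support of its limit is countable, and
    over a countable set the supremum of any chain commutes with the integral.\<close>
  let ?M = "count_space (set_spmf (lub_spmf Y))"
  have chain': "Complete_Partial_Order.chain (\<le>) ((\<lambda>p x. ennreal (spmf p x) * f x) ` Y)"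
    using chain by (rule chain_imageI)
      (auto simp: le_fun_def dest: ord_spmf_eq_leD intro!: mult_mono ennreal_leI)
  have "(\<integral>\<^sup>+ x. f x \<partial>measure_spmf (lub_spmf Y)) =
      (\<integral>\<^sup>+ x. ennreal (spmf (lub_spmf Y) x) * f x \<partial>?M)"
    by (simp add: nn_integral_measure_spmf')
  also have "\<dots> = (\<integral>\<^sup>+ x. (SUP p\<in>Y. ennreal (spmf p x) * f x) \<partial>?M)"
    by (subst ennreal_spmf_lub_spmf[OF chain Y]) (subst SUP_mult_right_ennreal, simp_all add: Y)
  also have "\<dots> = (SUP p\<in>Y. \<integral>\<^sup>+ x. ennreal (spmf p x) * f x \<partial>?M)"
    using Y chain' by (rule nn_integral_monotone_convergence_SUP_countable) simp
  also have "\<dots> = (SUP p\<in>Y. \<integral>\<^sup>+ x. f x \<partial>measure_spmf p)"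
    by (auto simp: nn_integral_measure_spmf nn_integral_count_space_indicator
        set_lub_spmf[OF chain] in_set_spmf_iff_spmf intro!: arg_cong[of _ _ Sup] image_cong
        nn_integral_cong split: split_indicator)
  also have "\<dots> \<le> c" using le by (auto intro: SUP_least)
  finally show "(\<integral>\<^sup>+ x. f x \<partial>measure_spmf (lub_spmf Y)) \<le> c" .
qed

lemma nn_integral_bind_spmf:
  "(\<integral>\<^sup>+ x. f x \<partial>measure_spmf (bind_spmf p h)) =
   (\<integral>\<^sup>+ y. (\<integral>\<^sup>+ x. f x \<partial>measure_spmf (h y)) \<partial>measure_spmf p)"
  apply (simp add: measure_spmf_bind)
  apply (subst nn_integral_bind[where B="count_space UNIV"])
  apply auto
  done

lemma nn_integral_bind_spmf_of_pmf:
  "(\<integral>\<^sup>+ x. f x \<partial>measure_spmf (bind_spmf (spmf_of_pmf p) h)) =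
   (\<integral>\<^sup>+ y. (\<integral>\<^sup>+ x. f x \<partial>measure_spmf (h y)) \<partial>measure_pmf p)"
  unfolding nn_integral_bind_spmf by simp

definition split_children :: "nat \<Rightarrow> nat \<Rightarrow> nat list \<Rightarrow> nat list \<Rightarrow> nat list list" where
  "split_children b s1 v ds =
     map (\<lambda>i. v @ [i]) (concat (map (\<lambda>i. replicate s1 i) [0..<b]) @ ds)"

text \<open>Mass lost to divergence only lowers the left-hand side, so termination is not needed.\<close>

lemma ins_balls_supermartingale:
  assumes place: "\<And>v rest C. nsub C v = 0 \<or> is_leaf C v \<and> C v < s \<Longrightarrow>
      G rest (C(v := Suc (C v))) \<le> G (v # rest) C"
    and move: "\<And>v rest C. nsub C v \<noteq> 0 \<Longrightarrow> \<not> is_leaf C v \<Longrightarrow>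
      (\<integral>\<^sup>+ i. G ((v @ [i]) # rest) C \<partial>measure_pmf (child_pmf b (\<omega> v))) \<le> G (v # rest) C"
    and split: "\<And>v rest C. is_leaf C v \<Longrightarrow> s \<le> C v \<Longrightarrow>
      (\<integral>\<^sup>+ ds. G (split_children b s1 v ds @ rest) (C(v := s0))
        \<partial>measure_pmf (replicate_pmf (s + 1 - s0 - b * s1) (child_pmf b (\<omega> v)))) \<le> G (v # rest) C"
  shows "(\<integral>\<^sup>+ C'. G [] C' \<partial>measure_spmf (ins_balls b s s0 s1 \<omega> vs C)) \<le> (G vs C :: ennreal)"
proof -
  let ?P = "\<lambda>ins. \<forall>vs C. (\<integral>\<^sup>+ C'. G [] C' \<partial>measure_spmf (ins b s s0 s1 \<omega> vs C)) \<le> G vs C"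
  have "?P ins_balls"
  proof (induction rule: ins_balls.fixp_induct)
    case 1
    show ?case
      unfolding curry_def
      by (intro admissible_all admissible_subst[OF admissible_nn_integral_spmf_le] mcont_call)
  next
    case 2
    then show ?case by simp
  next
    case (3 ins)
    then have IH: "(\<integral>\<^sup>+ C'. G [] C' \<partial>measure_spmf (ins b s s0 s1 \<omega> vs C)) \<le> G vs C" for vs C
      by blast
    show ?case
    proof (intro allI)
      fix vs C
      show "(\<integral>\<^sup>+ C'. G [] C' \<partial>measure_spmf (case vs of [] \<Rightarrow> return_spmf C
            | v # rest \<Rightarrow>
                if nsub C v = 0 \<or> is_leaf C v \<and> C v < s
                then ins b s s0 s1 \<omega> rest (C(v := Suc (C v)))
                else if \<not> is_leaf C v
                     then spmf_of_pmf (child_pmf b (\<omega> v)) \<bind>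
                          (\<lambda>i. ins b s s0 s1 \<omega> ((v @ [i]) # rest) C)
                     else spmf_of_pmf (replicate_pmf (s + 1 - s0 - b * s1) (child_pmf b (\<omega> v))) \<bind>
                          (\<lambda>ds. ins b s s0 s1 \<omega>
                                 (map (\<lambda>i. v @ [i]) (concat (map (\<lambda>i. replicate s1 i) [0..<b]) @ ds) @ rest)
                                 (C(v := s0))))) \<le> G vs C"
      proof (cases vs)
        case Nil
        then show ?thesis by (simp add: measure_spmf_return_spmf nn_integral_return)
      next
        case (Cons v rest)
        consider "nsub C v = 0 \<or> is_leaf C v \<and> C v < s" | "nsub C v \<noteq> 0" "\<not> is_leaf C v"
          | "is_leaf C v" "s \<le> C v" "nsub C v \<noteq> 0"
          by (metis is_leaf_def not_gr_zero linorder_not_less)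
        then show ?thesis
        proof cases
          case 1
          then show ?thesis using place[OF 1, of rest] IH[of rest "C(v := Suc (C v))"] Cons
            by (auto intro: order_trans)
        next
          case 2
          have "(\<integral>\<^sup>+ i. (\<integral>\<^sup>+ C'. G [] C' \<partial>measure_spmf (ins b s s0 s1 \<omega> ((v @ [i]) # rest) C))
              \<partial>measure_pmf (child_pmf b (\<omega> v))) \<le> G vs C"
            unfolding Cons by (rule order_trans[OF nn_integral_mono move[OF 2]]) (rule IH)
          then show ?thesis using 2 Cons
            by (simp add: nn_integral_bind_spmf_of_pmf del: bind_spmf_of_pmf)
        next
          case 3
          have "(\<integral>\<^sup>+ ds. (\<integral>\<^sup>+ C'. G [] C' \<partial>measure_spmf (ins b s s0 s1 \<omega> (split_children b s1 v ds @ rest) (C(v := s0))))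
              \<partial>measure_pmf (replicate_pmf (s + 1 - s0 - b * s1) (child_pmf b (\<omega> v)))) \<le> G vs C"
            unfolding Cons by (rule order_trans[OF nn_integral_mono split[OF 3(1,2)]]) (rule IH)
          then show ?thesis using 3 Cons
            by (simp add: nn_integral_bind_spmf_of_pmf split_children_def del: bind_spmf_of_pmf)
        qed
      qed
    qed
  qed
  then show ?thesis by blast
qed

section \<open>Ball counts in subtrees and an invariant for states with balls in hand\<close>

lemma nsub_alt:
  assumes "finite A" "{w. C w \<noteq> 0} \<subseteq> A"
  shows "nsub C v = (\<Sum>w\<in>A. if prefix v w then C w else 0)"
proof -
  have "nsub C v = (\<Sum>w\<in>{w. prefix v w \<and> C w \<noteq> 0}. if prefix v w then C w else 0)"
    unfolding nsub_def by (intro sum.cong) auto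
  also have "\<dots> = (\<Sum>w\<in>A. if prefix v w then C w else 0)"
    using assms by (intro sum.mono_neutral_left) auto
  finally show ?thesis .
qed

text \<open>Both sides carry a summand so that no subtraction of natural numbers occurs; placing a
  ball and splitting a leaf are both instances.\<close>

lemma nsub_fun_upd:
  assumes "finite {w. C w \<noteq> 0}"
  shows "nsub (C(v := k)) x + (if prefix x v then C v else 0) =
    nsub C x + (if prefix x v then k else 0)"
proof -
  let ?A = "insert v {w. C w \<noteq> 0}"
  have fin: "finite ?A" and v: "v \<in> ?A" using assms by auto
  have 1: "nsub C x = (\<Sum>w\<in>?A. if prefix x w then C w else 0)"
    by (rule nsub_alt[OF fin]) auto
  have 2: "nsub (C(v := k)) x = (\<Sum>w\<in>?A. if prefix x w then (C(v := k)) w else 0)"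
    by (rule nsub_alt[OF fin]) auto
  have 3: "(\<Sum>w\<in>?A - {v}. if prefix x w then (C(v := k)) w else 0) =
      (\<Sum>w\<in>?A - {v}. if prefix x w then C w else 0)"
    by (intro sum.cong) auto
  show ?thesis unfolding 1 2 sum.remove[OF fin v] 3 by auto
qed

lemma nsub_ge:
  assumes "finite {w. C w \<noteq> 0}" "prefix x w"
  shows "C w \<le> nsub C x"
proof (cases "C w = 0")
  case False
  have "C w = (\<Sum>u\<in>{w}. C u)" by simp
  also have "\<dots> \<le> nsub C x" unfolding nsub_def
    using assms False by (intro sum_mono2) auto
  finally show ?thesis .
qed simp

lemma nsub_eq_self_iff:
  assumes fin: "finite {w. C w \<noteq> 0}"
  shows "C v = nsub C v \<longleftrightarrow> (\<forall>w. strict_prefix v w \<longrightarrow> C w = 0)"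
proof -
  let ?B = "{w. strict_prefix v w \<and> C w \<noteq> 0}"
  have finB: "finite ?B" using fin by (rule rev_finite_subset) auto
  have "nsub C v = (\<Sum>w\<in>insert v ?B. C w)"
    unfolding nsub_def using finB
    by (intro sum.mono_neutral_left) (auto simp: strict_prefix_def)
  also have "\<dots> = C v + (\<Sum>w\<in>?B. C w)"
    using finB by (subst sum.insert) auto
  finally have "nsub C v = C v + (\<Sum>w\<in>?B. C w)" .
  then have "C v = nsub C v \<longleftrightarrow> (\<Sum>w\<in>?B. C w) = 0" by auto
  also have "\<dots> \<longleftrightarrow> (\<forall>w\<in>?B. C w = 0)" using finB by simp
  finally show ?thesis by auto
qed

lemma nsub_children_le:
  assumes fin: "finite {w. C w \<noteq> 0}" and "i \<noteq> j"
  shows "nsub C (u @ [i]) + nsub C (u @ [j]) \<le> nsub C u"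
proof -
  have "nsub C (u @ [i]) + nsub C (u @ [j]) =
     (\<Sum>w\<in>{w. C w \<noteq> 0}. (if prefix (u @ [i]) w then C w else 0) + (if prefix (u @ [j]) w then C w else 0))"
    using nsub_alt[OF fin subset_refl] by (simp add: sum.distrib)
  also have "\<dots> \<le> (\<Sum>w\<in>{w. C w \<noteq> 0}. if prefix u w then C w else 0)"
    using assms by (intro sum_mono) (auto simp: prefix_def)
  also have "\<dots> = nsub C u" using nsub_alt[OF fin subset_refl] by simp
  finally show ?thesis .
qed

text \<open>The balls in hand count as if they were lying at the vertices where they currently arrive.\<close>

definition below :: "nat list list \<Rightarrow> (nat list \<Rightarrow> nat) \<Rightarrow> nat list \<Rightarrow> bool" where
  "below vs C x \<longleftrightarrow> (\<exists>w. (C w \<noteq> 0 \<or> w \<in> set vs) \<and> strict_prefix x w)"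

definition ntot :: "nat list list \<Rightarrow> (nat list \<Rightarrow> nat) \<Rightarrow> nat list \<Rightarrow> nat" where
  "ntot vs C x = nsub C x + length (filter (prefix x) vs)"

text \<open>The fourth conjunct says that several balls are in hand only just after a leaf was split,
  when they can be placed one after the other without any further splitting until
  a single ball is left.\<close>

definition wf_state ::
  "nat \<Rightarrow> nat \<Rightarrow> nat \<Rightarrow> nat list list \<Rightarrow> (nat list \<Rightarrow> nat) \<Rightarrow> bool" where
  "wf_state b s s1 vs C \<longleftrightarrow>
     finite {w. C w \<noteq> 0} \<and> (\<forall>w. C w \<le> s) \<and>
     (\<forall>w. C w \<noteq> 0 \<or> w \<in> set vs \<longrightarrow> set w \<subseteq> {..<b}) \<and>
     (length vs \<le> 1 \<or> (\<forall>x\<in>set vs. C x + length vs \<le> s + 1 \<and> \<not> below vs C x)) \<and>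
     (\<forall>x. below vs C x \<longrightarrow> s + 1 \<le> ntot vs C x \<and> (\<forall>i<b. s1 \<le> ntot vs C (x @ [i])))"

text \<open>A ball in hand at \<open>v\<close> and a ball lying at \<open>v\<close> count alike in
  \<open>ntot\<close> and \<open>below\<close>. In the fourth conjunct of the invariant the growth
  of \<open>C v\<close> is paid for by the shorter list.\<close>

lemma wf_state_place:
  assumes wf: "wf_state b s s1 (v # rest) C" and s: "s \<ge> 1"
    and cond: "nsub C v = 0 \<or> is_leaf C v \<and> C v < s"
  shows "wf_state b s s1 rest (C(v := Suc (C v)))"
    and "\<And>x. below rest (C(v := Suc (C v))) x \<longleftrightarrow> below (v # rest) C x"
    and "C v < s"
proof -
  let ?C = "C(v := Suc (C v))"
  have fin: "finite {w. C w \<noteq> 0}" using wf by (simp add: wf_state_def)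
  show lt: "C v < s" using cond s nsub_ge[OF fin, of v v] by auto
  show below: "below rest ?C x \<longleftrightarrow> below (v # rest) C x" for x
    unfolding below_def by auto
  have ntot: "ntot rest ?C x = ntot (v # rest) C x" for x
    using nsub_fun_upd[OF fin, of v "Suc (C v)" x] unfolding ntot_def by (auto split: if_splits)
  show "wf_state b s s1 rest ?C"
    unfolding wf_state_def below ntot
  proof (intro conjI)
    show "finite {w. ?C w \<noteq> 0}"
      by (rule finite_subset[of _ "insert v {w. C w \<noteq> 0}"]) (use fin in auto)
    show "length rest \<le> 1 \<or> (\<forall>x\<in>set rest. ?C x + length rest \<le> s + 1 \<and> \<not> below (v # rest) C x)"
      using wf unfolding wf_state_def by auto
  qed (use wf lt in \<open>auto simp: wf_state_def\<close>)
qed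

lemma strict_prefix_snoc: "strict_prefix x v \<Longrightarrow> strict_prefix x (v @ [i])"
  by (rule prefix_order.less_le_trans) auto

text \<open>A ball moves on only from a vertex with balls strictly below it, and then the fourth
  conjunct of \<open>wf_state\<close> allows no second ball in hand. The new position adds only the
  prefix \<open>v\<close> to \<open>below\<close>, where it already held.\<close>

lemma wf_state_move:
  assumes wf: "wf_state b s s1 (v # rest) C" and "nsub C v \<noteq> 0" "\<not> is_leaf C v" and i: "i < b"
  shows "wf_state b s s1 ((v @ [i]) # rest) C"
    and "\<And>x. below ((v @ [i]) # rest) C x \<longleftrightarrow> below (v # rest) C x"
proof -
  have fin: "finite {w. C w \<noteq> 0}" using wf by (simp add: wf_state_def)
  obtain w where w: "strict_prefix v w" "C w \<noteq> 0"
    using assms(2,3) nsub_eq_self_iff[OF fin, of v] unfolding is_leaf_def by auto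
  then have bv: "below (v # rest) C v" unfolding below_def by auto
  with wf have [simp]: "rest = []" unfolding wf_state_def by (cases rest) auto
  show below: "below ((v @ [i]) # rest) C x \<longleftrightarrow> below (v # rest) C x" for x
  proof
    assume "below ((v @ [i]) # rest) C x"
    then show "below (v # rest) C x"
      using bv unfolding below_def by (auto simp: strict_prefix_def)
  next
    assume "below (v # rest) C x"
    then show "below ((v @ [i]) # rest) C x"
      unfolding below_def by (auto intro: strict_prefix_snoc)
  qed
  have ntot: "ntot (v # rest) C x \<le> ntot ((v @ [i]) # rest) C x" for x
    unfolding ntot_def by auto
  show "wf_state b s s1 ((v @ [i]) # rest) C"
    unfolding wf_state_def below
  proof (intro conjI)
    show "\<forall>x. below (v # rest) C x \<longrightarrow> s + 1 \<le> ntot ((v @ [i]) # rest) C x \<and>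
        (\<forall>j<b. s1 \<le> ntot ((v @ [i]) # rest) C (x @ [j]))"
    proof (intro allI impI)
      fix x assume "below (v # rest) C x"
      then have "s + 1 \<le> ntot (v # rest) C x \<and> (\<forall>j<b. s1 \<le> ntot (v # rest) C (x @ [j]))"
        using wf unfolding wf_state_def by blast
      then show "s + 1 \<le> ntot ((v @ [i]) # rest) C x \<and>
          (\<forall>j<b. s1 \<le> ntot ((v @ [i]) # rest) C (x @ [j]))"
        using ntot order_trans by blast
    qed
  qed (use wf i in \<open>auto simp: wf_state_def\<close>)
qed

lemma set_split_children:
  "set ds \<subseteq> {..<b} \<Longrightarrow> x \<in> set (split_children b s1 v ds) \<Longrightarrow> \<exists>i<b. x = v @ [i]"
  unfolding split_children_def by auto

lemma length_concat_replicate: "length (concat (map (\<lambda>i. replicate k i) [0..<b])) = b * k"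
  by (induction b) auto

lemma count_concat_replicate:
  "i < b \<Longrightarrow> length (filter ((=) i) (concat (map (\<lambda>i. replicate k i) [0..<b]))) = k"
proof (induction b)
  case (Suc b)
  have "length (filter ((=) b) (concat (map (\<lambda>i. replicate k i) [0..<b]))) = 0"
    by (auto simp: filter_empty_conv)
  with Suc show ?case by (cases "i = b") auto
qed simp

text \<open>A full leaf has \<open>C v = s\<close>, so the bound \<open>s + 1\<close> in the fourth
  conjunct forces \<open>rest\<close> to be empty: exactly \<open>s + 1\<close> balls are
  redistributed. The children of a leaf are empty, hence the at most \<open>s + 1\<close> balls now
  in hand satisfy the fourth conjunct again. \<open>below\<close> changes at \<open>v\<close> only,
  so it records which vertices have been split.\<close>

lemma wf_state_split:
  assumes wf: "wf_state b s s1 (v # rest) C" and leaf: "is_leaf C v" "s \<le> C v"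
    and params: "s \<ge> 1" "s0 \<le> s" "b * s1 \<le> s + 1 - s0"
    and ds: "set ds \<subseteq> {..<b}" "length ds = s + 1 - s0 - b * s1"
  shows "wf_state b s s1 (split_children b s1 v ds @ rest) (C(v := s0))"
    and "\<And>x. below (split_children b s1 v ds @ rest) (C(v := s0)) x \<longleftrightarrow> x = v \<or> below (v # rest) C x"
    and "rest = []" and "C v = s" and "\<not> below (v # rest) C v"
proof -
  let ?vs = "split_children b s1 v ds" and ?C = "C(v := s0)"
  have fin: "finite {w. C w \<noteq> 0}" using wf by (simp add: wf_state_def)
  show Cv: "C v = s" using wf leaf unfolding wf_state_def by (auto intro: antisym)
  have r: "length rest = 0"
    using wf Cv unfolding wf_state_def by (auto dest: bspec)
  then show rest[simp]: "rest = []" by simp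
  have no: "C w = 0" if "strict_prefix v w" for w
    using leaf(1) that nsub_eq_self_iff[OF fin] unfolding is_leaf_def by auto
  then show nb: "\<not> below (v # rest) C v" unfolding below_def by auto
  have len: "length ?vs = s + 1 - s0"
    using params ds unfolding split_children_def by (simp add: length_concat_replicate)
  \<comment> \<open>As \<open>s0\<close> \<le> \<open>s\<close>, at least one ball leaves
    \<open>v\<close>; it is the witness that \<open>below\<close> becomes true at
    \<open>v\<close>.\<close>
  then have "?vs \<noteq> []" using params by auto
  then obtain y where y: "y \<in> set ?vs" by (meson list.set_sel(1))
  then obtain j where j: "y = v @ [j]" using set_split_children[OF ds(1)] by blast
  show below: "below (?vs @ rest) ?C x \<longleftrightarrow> x = v \<or> below (v # rest) C x" for x
  proof
    assume "below (?vs @ rest) ?C x"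
    then obtain w where w: "?C w \<noteq> 0 \<or> w \<in> set ?vs" "strict_prefix x w"
      unfolding below_def by auto
    show "x = v \<or> below (v # rest) C x"
    proof (cases "w \<in> set ?vs")
      case True
      then obtain i where "w = v @ [i]" using set_split_children[OF ds(1)] by blast
      with w(2) show ?thesis unfolding below_def by (auto simp: strict_prefix_def)
    next
      case False
      with w show ?thesis unfolding below_def by (auto split: if_splits)
    qed
  next
    assume "x = v \<or> below (v # rest) C x"
    then consider "x = v" | w where "C w \<noteq> 0" "w \<noteq> v" "strict_prefix x w" | "strict_prefix x v"
      unfolding below_def by auto
    then show "below (?vs @ rest) ?C x"
    proof cases
      case 1
      then show ?thesis using y j unfolding below_def by (auto simp: strict_prefix_def)
    next
      case 2
      then show ?thesis unfolding below_def by auto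
    next
      case 3
      then have "strict_prefix x (v @ [j])" by (rule strict_prefix_snoc)
      then show ?thesis using y j unfolding below_def by auto
    qed
  qed
  have pre: "filter (prefix x) ?vs = ?vs" if "prefix x v" for x
    using that set_split_children[OF ds(1)]
    by (auto simp: filter_id_conv dest!: set_split_children[OF ds(1)])
  have ntot: "ntot (v # rest) C x \<le> ntot (?vs @ rest) ?C x" for x
    using nsub_fun_upd[OF fin, of v s0 x] Cv len params
    unfolding ntot_def by (auto simp: pre split: if_splits)
  have ntot_v: "s + 1 \<le> ntot (?vs @ rest) ?C v"
    using nsub_fun_upd[OF fin, of v s0 v] Cv len params nsub_ge[OF fin, of v v]
    unfolding ntot_def by (auto simp: pre)
  have ntot_child: "s1 \<le> ntot (?vs @ rest) ?C (v @ [i])" if "i < b" for i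
  proof -
    have "s1 = length (filter ((=) i) (concat (map (\<lambda>i. replicate s1 i) [0..<b])))"
      by (simp add: count_concat_replicate that)
    also have "\<dots> \<le> length (filter (prefix (v @ [i])) ?vs)"
      unfolding split_children_def by (simp add: filter_map o_def)
    finally show ?thesis unfolding ntot_def by simp
  qed
  have no2: "\<not> below (?vs @ rest) ?C (v @ [i])" for i
  proof
    assume "below (?vs @ rest) ?C (v @ [i])"
    then obtain w where w: "C w \<noteq> 0 \<or> w = v" "strict_prefix (v @ [i]) w"
      unfolding below by (auto simp: below_def)
    then have "strict_prefix v w" using strict_prefix_snoc
      by (metis prefixI prefix_order.le_less_trans)
    with no w(1) show False by auto
  qed
  have C0: "C (v @ [i]) = 0" for i using no[of "v @ [i]"] by (auto simp: strict_prefix_def)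
  show "wf_state b s s1 (?vs @ rest) ?C"
    unfolding wf_state_def
  proof (intro conjI)
    show "finite {w. ?C w \<noteq> 0}"
      by (rule finite_subset[of _ "insert v {w. C w \<noteq> 0}"]) (use fin in auto)
    show "\<forall>w. ?C w \<le> s" using wf params by (auto simp: wf_state_def)
    show "\<forall>w. ?C w \<noteq> 0 \<or> w \<in> set (?vs @ rest) \<longrightarrow> set w \<subseteq> {..<b}"
    proof -
      have "set w \<subseteq> {..<b}" if "C w \<noteq> 0 \<or> w = v" for w
        using wf that unfolding wf_state_def by auto
      then show ?thesis by (auto dest!: set_split_children[OF ds(1)] simp del: subsetI) (auto split: if_splits)
    qed
    show "length (?vs @ rest) \<le> 1 \<or>
      (\<forall>x\<in>set (?vs @ rest). ?C x + length (?vs @ rest) \<le> s + 1 \<and> \<not> below (?vs @ rest) ?C x)"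
      using no2 C0 len by (auto dest!: set_split_children[OF ds(1)])
    show "\<forall>x. below (?vs @ rest) ?C x \<longrightarrow> s + 1 \<le> ntot (?vs @ rest) ?C x \<and>
         (\<forall>i<b. s1 \<le> ntot (?vs @ rest) ?C (x @ [i]))"
    proof (intro allI impI)
      fix x assume "below (?vs @ rest) ?C x"
      then consider "x = v" | "below (v # rest) C x" using below by blast
      then show "s + 1 \<le> ntot (?vs @ rest) ?C x \<and> (\<forall>i<b. s1 \<le> ntot (?vs @ rest) ?C (x @ [i]))"
      proof cases
        case 1
        then show ?thesis using ntot_v ntot_child by auto
      next
        case 2
        with wf have "s + 1 \<le> ntot (v # rest) C x \<and> (\<forall>i<b. s1 \<le> ntot (v # rest) C (x @ [i]))"
          unfolding wf_state_def by blast
        then show ?thesis using ntot order_trans by blast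
      qed
    qed
  qed
qed

text \<open>Balls below a child of \<open>u\<close> mean that this child holds at least \<open>s + 1\<close> balls and that
  each of its siblings got \<open>s1\<close> of them.\<close>

lemma nsub_grandparent_ge:
  assumes wf: "wf_state b s s1 [] C" and b: "b \<ge> 2" and i: "i < b" and pos: "nsub C (u @ [i, j]) > 0"
  shows "nsub C u \<ge> s + 1 + s1"
proof -
  have fin: "finite {w. C w \<noteq> 0}" using wf by (simp add: wf_state_def)
  from pos obtain w where w: "prefix (u @ [i, j]) w" "C w \<noteq> 0"
    unfolding nsub_def by (metis (mono_tags, lifting) empty_Collect_eq neq0_conv sum.empty)
  have "strict_prefix (u @ [i]) w" "strict_prefix u w" using w(1) by (auto simp: strict_prefix_def prefix_def)
  then have 1: "below [] C (u @ [i])" "below [] C u" using w(2) by (auto simp: below_def)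
  \<comment> \<open>Any sibling of \<open>i\<close> will do; it exists because \<open>b\<close>
    \<ge> 2, and its \<open>s1\<close> balls come on top of the \<open>s + 1\<close> below
    \<open>i\<close>.\<close>
  define i' where "i' = (if i = 0 then 1 else 0 :: nat)"
  have i': "i' < b" "i' \<noteq> i" using b by (auto simp: i'_def)
  have "s + 1 \<le> nsub C (u @ [i])" "s1 \<le> nsub C (u @ [i'])"
    using 1 wf i i' unfolding wf_state_def ntot_def by auto
  then show ?thesis using nsub_children_le[OF fin i'(2)[symmetric], of u] by simp
qed

section \<open>A martingale for the positions of the balls\<close>

definition simplex_vec :: "nat \<Rightarrow> (nat \<Rightarrow> real) \<Rightarrow> bool" where
  "simplex_vec b w \<longleftrightarrow> (\<forall>i<b. 0 \<le> w i) \<and> (\<Sum>i<b. w i) = 1"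

lemma pmf_child_pmf:
  assumes "simplex_vec b w"
  shows "pmf (child_pmf b w) i = (if i < b then w i else 0)"
proof -
  have w: "\<forall>i<b. 0 \<le> w i" "(\<Sum>i<b. w i) = 1" using assms by (auto simp: simplex_vec_def)
  have "(\<integral>\<^sup>+ i. ennreal (if i < b then w i else 0) \<partial>count_space UNIV) =
      (\<integral>\<^sup>+ i. ennreal (w i) * indicator {..<b} i \<partial>count_space UNIV)"
    by (intro nn_integral_cong) (auto split: split_indicator)
  also have "\<dots> = (\<Sum>i<b. ennreal (w i))"
    by (simp add: nn_integral_count_space_indicator[symmetric] nn_integral_count_space_finite)
  also have "\<dots> = 1" using w by (subst sum_ennreal) auto
  finally show ?thesis
    unfolding child_pmf_def using w by (simp add: pmf_embed_pmf)
qed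

lemma set_child_pmf: "simplex_vec b w \<Longrightarrow> set_pmf (child_pmf b w) \<subseteq> {..<b}"
  by (auto simp: set_pmf_iff pmf_child_pmf split: if_splits)

lemma nn_integral_child_pmf:
  assumes "simplex_vec b w"
  shows "(\<integral>\<^sup>+ i. f i \<partial>measure_pmf (child_pmf b w)) = (\<Sum>i<b. f i * ennreal (w i))"
  using assms set_child_pmf[OF assms]
  by (subst nn_integral_measure_pmf_support[of "{..<b}"])
     (auto simp: pmf_child_pmf set_pmf_iff)

lemma nn_integral_replicate_pmf_prod_list:
  fixes f :: "'a \<Rightarrow> ennreal"
  shows "(\<integral>\<^sup>+ xs. prod_list (map f xs) \<partial>measure_pmf (replicate_pmf n p)) =
    (\<integral>\<^sup>+ x. f x \<partial>measure_pmf p) ^ n"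
proof (induction n)
  case (Suc n)
  then show ?case
    by (simp add: nn_integral_cmult nn_integral_multc)
qed simp

lemma ennreal_prod_list:
  "(\<And>x. x \<in> set xs \<Longrightarrow> 0 \<le> f x) \<Longrightarrow> ennreal (prod_list (map f xs)) = prod_list (map (\<lambda>x. ennreal (f x)) xs)"
  by (induction xs) (auto simp: ennreal_mult')

definition ball_prod :: "(nat list \<Rightarrow> real) \<Rightarrow> (nat list \<Rightarrow> nat) \<Rightarrow> real" where
  "ball_prod a C = (\<Prod>w\<in>{w. C w \<noteq> 0}. a w ^ C w)"

lemma ball_prod_alt:
  assumes "finite A" "{w. C w \<noteq> 0} \<subseteq> A"
  shows "ball_prod a C = (\<Prod>w\<in>A. a w ^ C w)"
  unfolding ball_prod_def using assms by (intro prod.mono_neutral_left) auto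

lemma ball_prod_fun_upd:
  assumes "finite {w. C w \<noteq> 0}"
  shows "ball_prod a (C(v := k)) * a v ^ C v = ball_prod a C * a v ^ k"
proof -
  let ?A = "insert v {w. C w \<noteq> 0}"
  have fin: "finite ?A" and v: "v \<in> ?A" using assms by auto
  have 1: "ball_prod a C = (\<Prod>w\<in>?A. a w ^ C w)"
    by (rule ball_prod_alt[OF fin]) auto
  have 2: "ball_prod a (C(v := k)) = (\<Prod>w\<in>?A. a w ^ (C(v := k)) w)"
    by (rule ball_prod_alt[OF fin]) auto
  have 3: "(\<Prod>w\<in>?A - {v}. a w ^ (C(v := k)) w) = (\<Prod>w\<in>?A - {v}. a w ^ C w)"
    by (intro prod.cong) auto
  show ?thesis unfolding 1 2 prod.remove[OF fin v] 3 by simp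
qed

lemma prod_list_concat_replicate:
  fixes f :: "nat \<Rightarrow> real"
  shows "prod_list (map f (concat (map (\<lambda>i. replicate k i) [0..<b]))) = (\<Prod>i<b. f i) ^ k"
  by (induction b) (auto simp: power_mult_distrib map_replicate_const prod_list_replicate)

text \<open>The weight \<open>a\<close> is harmonic for the walk of a ball, so that the product of the
  weights of independently moving balls is a martingale. The factors \<open>forced u\<close> compensate for
  the \<open>s1\<close> balls that are sent to each child of a split vertex \<open>u\<close>.\<close>

locale harmonic_weight =
  fixes b s s0 s1 :: nat and \<omega> :: "nat list \<Rightarrow> nat \<Rightarrow> real" and t :: "nat list"
    and a :: "nat list \<Rightarrow> real"
  assumes s: "s \<ge> 1" and s0: "s0 \<le> s" and s1: "b * s1 \<le> s + 1 - s0"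
    and simplex: "\<And>u. simplex_vec b (\<omega> u)"
    and a_pos: "\<And>u. a u > 0"
    and harmonic: "\<And>u. (\<Sum>i<b. a (u @ [i]) * \<omega> u i) = a u"
    and off_path: "\<And>u i. \<not> strict_prefix u t \<Longrightarrow> a (u @ [i]) = a u"
begin

text \<open>Taken as random steps, the \<open>b * s1\<close> forced balls would contribute
  \<open>a u ^ (b * s1)\<close> in mean; in fact they contribute the \<open>s1\<close>-th power of
  the product over the children. This is the quotient of the two.\<close>

definition forced :: "nat list \<Rightarrow> real" where
  "forced u = (a u ^ b / (\<Prod>i<b. a (u @ [i]))) ^ s1"

text \<open>\<open>below vs C u\<close> expresses that \<open>u\<close> has been split. Only strict
  prefixes of \<open>t\<close> are listed, which keeps the product finite; elsewhere
  \<open>forced\<close> equals 1.\<close>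

definition pot :: "nat list list \<Rightarrow> (nat list \<Rightarrow> nat) \<Rightarrow> real" where
  "pot vs C = ball_prod a C * prod_list (map a vs) *
     (\<Prod>u\<in>{u. strict_prefix u t \<and> below vs C u}. forced u)"

text \<open>The value infinity makes the one-step inequalities trivial outside the invariant, where
  they are also demanded. Conversely, a finite mean later shows that the invariant holds almost
  surely.\<close>

definition epot :: "nat list list \<Rightarrow> (nat list \<Rightarrow> nat) \<Rightarrow> ennreal" where
  "epot vs C = (if wf_state b s s1 vs C then ennreal (pot vs C) else \<infinity>)"

lemma finite_strict_prefixes: "finite {u. strict_prefix u t \<and> P u}"
  by (rule finite_subset[of _ "set (prefixes t)"]) (auto simp: strict_prefix_def)

lemma prod_children_pos: "(\<Prod>i<b. a (u @ [i])) > 0"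
  using a_pos by (intro prod_pos) auto

lemma forced_pos: "forced u > 0"
  unfolding forced_def using prod_children_pos a_pos by (intro zero_less_power divide_pos_pos) auto

lemma forced_off_path: "\<not> strict_prefix u t \<Longrightarrow> forced u = 1"
  using a_pos[of u] by (simp add: forced_def off_path)

lemma nn_integral_a:
  "(\<integral>\<^sup>+ i. ennreal (a (u @ [i])) \<partial>measure_pmf (child_pmf b (\<omega> u))) = ennreal (a u)"
proof -
  have "(\<integral>\<^sup>+ i. ennreal (a (u @ [i])) \<partial>measure_pmf (child_pmf b (\<omega> u))) =
      (\<Sum>i<b. ennreal (a (u @ [i]) * \<omega> u i))"
    using a_pos[THEN less_imp_le] simplex[of u]
    by (simp add: nn_integral_child_pmf[OF simplex] ennreal_mult simplex_vec_def)
  also have "\<dots> = ennreal (\<Sum>i<b. a (u @ [i]) * \<omega> u i)"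
    using a_pos[THEN less_imp_le] simplex[of u] by (subst sum_ennreal) (auto simp: simplex_vec_def)
  finally show ?thesis by (simp add: harmonic)
qed

lemma epot_place:
  assumes cond: "nsub C v = 0 \<or> is_leaf C v \<and> C v < s"
  shows "epot rest (C(v := Suc (C v))) \<le> epot (v # rest) C"
proof (cases "wf_state b s s1 (v # rest) C")
  case True
  note P = wf_state_place[OF True s cond]
  have fin: "finite {w. C w \<noteq> 0}" using True by (simp add: wf_state_def)
  have "ball_prod a (C(v := Suc (C v))) = ball_prod a C * a v"
    using ball_prod_fun_upd[OF fin, of a v "Suc (C v)"] a_pos[of v] by (simp add: field_simps)
  then have "pot rest (C(v := Suc (C v))) = pot (v # rest) C"
    unfolding pot_def P(2) by simp
  then show ?thesis using True P(1) by (simp add: epot_def)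
qed (simp add: epot_def)

lemma epot_move:
  assumes cond: "nsub C v \<noteq> 0" "\<not> is_leaf C v"
  shows "(\<integral>\<^sup>+ i. epot ((v @ [i]) # rest) C \<partial>measure_pmf (child_pmf b (\<omega> v))) \<le> epot (v # rest) C"
proof (cases "wf_state b s s1 (v # rest) C")
  case True
  note M = wf_state_move[OF True cond]
  define R where "R = ball_prod a C * prod_list (map a rest) *
     (\<Prod>u\<in>{u. strict_prefix u t \<and> below (v # rest) C u}. forced u)"
  have R: "R \<ge> 0" unfolding R_def ball_prod_def using a_pos forced_pos
    by (intro mult_nonneg_nonneg prod_nonneg prod_list_nonneg) (auto simp: less_imp_le)
  have "(\<integral>\<^sup>+ i. epot ((v @ [i]) # rest) C \<partial>measure_pmf (child_pmf b (\<omega> v))) =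
      (\<integral>\<^sup>+ i. ennreal R * ennreal (a (v @ [i])) \<partial>measure_pmf (child_pmf b (\<omega> v)))"
  proof (intro nn_integral_cong_AE AE_pmfI)
    fix i assume "i \<in> set_pmf (child_pmf b (\<omega> v))"
    then have i: "i < b" using set_child_pmf[OF simplex, of v] by auto
    show "epot ((v @ [i]) # rest) C = ennreal R * ennreal (a (v @ [i]))"
      using M[OF i] R a_pos[of "v @ [i]"]
      by (simp add: epot_def pot_def R_def ennreal_mult[symmetric] mult_ac)
  qed
  also have "\<dots> = ennreal (R * a v)"
    using R a_pos[of v] by (simp add: nn_integral_cmult nn_integral_a ennreal_mult)
  also have "R * a v = pot (v # rest) C" by (simp add: R_def pot_def mult_ac)
  finally show ?thesis using True by (simp add: epot_def)
qed (simp add: epot_def)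

text \<open>By independence and harmonicity each freely moving ball contributes a factor
  \<open>a v\<close> in mean; \<open>forced v\<close> completes \<open>Q ^ s1\<close> to
  \<open>a v ^ (b * s1)\<close>. With the \<open>s0\<close> balls that stay, this restores the
  \<open>s + 1\<close> factors \<open>a v\<close> present before the split.\<close>

lemma epot_split:
  assumes leaf: "is_leaf C v" "s \<le> C v"
  shows "(\<integral>\<^sup>+ ds. epot (split_children b s1 v ds @ rest) (C(v := s0))
        \<partial>measure_pmf (replicate_pmf (s + 1 - s0 - b * s1) (child_pmf b (\<omega> v)))) \<le> epot (v # rest) C"
proof (cases "wf_state b s s1 (v # rest) C")
  case True
  let ?N = "s + 1 - s0 - b * s1" and ?C = "C(v := s0)"
  note S = wf_state_split[OF True leaf s s0 s1]
  have fin: "finite {w. C w \<noteq> 0}" using True by (simp add: wf_state_def)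
  \<comment> \<open>A dummy list of choices: the facts \<open>S0\<close> do not mention
    \<open>ds\<close>, but \<open>wf_state_split\<close> yields them only for an admissible
    \<open>ds\<close>.\<close>
  obtain i where "i \<in> set_pmf (child_pmf b (\<omega> v))" using set_pmf_not_empty by fast
  then have i: "i < b" using set_child_pmf[OF simplex, of v] by auto
  then have "set (replicate ?N i) \<subseteq> {..<b}" "length (replicate ?N i) = ?N" by (auto dest: in_set_replicate[THEN iffD1])
  note S0 = S(3,4,5)[OF this]
  define \<kappa> where "\<kappa> = (\<Prod>u\<in>{u. strict_prefix u t \<and> below (v # rest) C u}. forced u)"
  have \<kappa>: "\<kappa> \<ge> 0" unfolding \<kappa>_def using forced_pos by (intro prod_nonneg) (auto simp: less_imp_le)
  have bp: "ball_prod a ?C \<ge> 0" unfolding ball_prod_def using a_pos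
    by (intro prod_nonneg) (auto simp: less_imp_le)
  define Q where "Q = (\<Prod>i<b. a (v @ [i]))"
  have Q: "Q > 0" unfolding Q_def by (rule prod_children_pos)
  define R where "R = ball_prod a ?C * Q ^ s1 * (forced v * \<kappa>)"
  have R: "R \<ge> 0" unfolding R_def using bp Q \<kappa> forced_pos[of v] by (intro mult_nonneg_nonneg) auto
  have "(\<integral>\<^sup>+ ds. epot (split_children b s1 v ds @ rest) ?C \<partial>measure_pmf (replicate_pmf ?N (child_pmf b (\<omega> v)))) =
      (\<integral>\<^sup>+ ds. ennreal R * prod_list (map (\<lambda>i. ennreal (a (v @ [i]))) ds)
         \<partial>measure_pmf (replicate_pmf ?N (child_pmf b (\<omega> v))))"
  proof (intro nn_integral_cong_AE AE_pmfI)
    fix ds assume "ds \<in> set_pmf (replicate_pmf ?N (child_pmf b (\<omega> v)))"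
    then have ds: "set ds \<subseteq> {..<b}" "length ds = ?N"
      using set_child_pmf[OF simplex, of v] by (auto simp: set_replicate_pmf)
    note W = S(1,2)[OF ds]
    have \<kappa>': "(\<Prod>u\<in>{u. strict_prefix u t \<and> below (split_children b s1 v ds @ rest) ?C u}. forced u) = forced v * \<kappa>"
    proof (cases "strict_prefix v t")
      case True
      then have "{u. strict_prefix u t \<and> below (split_children b s1 v ds @ rest) ?C u} =
          insert v {u. strict_prefix u t \<and> below (v # rest) C u}"
        unfolding W(2) by auto
      then show ?thesis unfolding \<kappa>_def using S0(3) finite_strict_prefixes by simp
    next
      case False
      then have "{u. strict_prefix u t \<and> below (split_children b s1 v ds @ rest) ?C u} =
          {u. strict_prefix u t \<and> below (v # rest) C u}"
        unfolding W(2) by auto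
      then show ?thesis unfolding \<kappa>_def using False by (simp add: forced_off_path)
    qed
    have "prod_list (map a (split_children b s1 v ds @ rest)) =
        Q ^ s1 * prod_list (map (\<lambda>i. a (v @ [i])) ds)"
      using prod_list_concat_replicate[of "\<lambda>i. a (v @ [i])" s1 b]
      by (simp add: split_children_def S0(1) Q_def o_def)
    then have "pot (split_children b s1 v ds @ rest) ?C = R * prod_list (map (\<lambda>i. a (v @ [i])) ds)"
      unfolding pot_def \<kappa>' by (simp add: R_def mult_ac)
    moreover have "prod_list (map (\<lambda>i. a (v @ [i])) ds) \<ge> 0"
      using a_pos by (intro prod_list_nonneg) (auto simp: less_imp_le)
    ultimately show "epot (split_children b s1 v ds @ rest) ?C =
        ennreal R * prod_list (map (\<lambda>i. ennreal (a (v @ [i]))) ds)"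
      using W(1) R a_pos by (simp add: epot_def ennreal_mult ennreal_prod_list less_imp_le)
  qed
  also have "\<dots> = ennreal (R * a v ^ ?N)"
    using R a_pos[of v]
    by (simp add: nn_integral_cmult nn_integral_replicate_pmf_prod_list nn_integral_a ennreal_mult
        ennreal_power less_imp_le)
  also have "R * a v ^ ?N = pot (v # rest) C"
  proof -
    have "Q ^ s1 * forced v = a v ^ (b * s1)"
      using Q by (simp add: forced_def Q_def[symmetric] power_divide power_mult)
    then have "R * a v ^ ?N = ball_prod a ?C * \<kappa> * (a v ^ (b * s1) * a v ^ ?N)"
      by (simp add: R_def mult_ac)
    also have "a v ^ (b * s1) * a v ^ ?N = a v ^ (s + 1 - s0)"
      by (metis le_add_diff_inverse power_add s1)
    also have "\<dots> = a v ^ (s - s0) * a v" using s0 by (simp add: Suc_diff_le)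
    finally have 1: "R * a v ^ ?N = (ball_prod a ?C * a v ^ (s - s0)) * a v * \<kappa>" by (simp only: mult_ac)
    have "ball_prod a ?C * a v ^ (s - s0) * a v ^ s0 = ball_prod a C * a v ^ s0"
      using ball_prod_fun_upd[OF fin, of a v s0] s0 by (simp add: S0(2) power_add[symmetric] mult.assoc)
    then have "ball_prod a ?C * a v ^ (s - s0) = ball_prod a C" using a_pos[of v] by simp
    with 1 show ?thesis by (simp add: pot_def S0(1) \<kappa>_def)
  qed
  finally have "(\<integral>\<^sup>+ ds. epot (split_children b s1 v ds @ rest) ?C
      \<partial>measure_pmf (replicate_pmf ?N (child_pmf b (\<omega> v)))) = ennreal (pot (v # rest) C)" .
  also have "\<dots> = epot (v # rest) C" using True by (simp add: epot_def)
  finally show ?thesis by (rule eq_refl)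
qed (simp add: epot_def)

lemma nn_integral_epot_ins_balls:
  "(\<integral>\<^sup>+ C'. epot [] C' \<partial>measure_spmf (ins_balls b s s0 s1 \<omega> vs C)) \<le> epot vs C"
  by (rule ins_balls_supermartingale) (fact epot_place epot_move epot_split)+

text \<open>The root has no strict prefix, so a ball in hand there changes no \<open>below\<close>
  and only adds the factor \<open>a []\<close>.\<close>

lemma epot_insert: "epot [[]] C \<le> epot [] C * ennreal (a [])"
proof (cases "wf_state b s s1 [] C")
  case True
  have below: "below [[]] C x \<longleftrightarrow> below [] C x" for x
    unfolding below_def by auto
  have ntot: "ntot [] C x \<le> ntot [[]] C x" for x by (simp add: ntot_def)
  have "wf_state b s s1 [[]] C"
    using True unfolding wf_state_def below by (auto intro: order_trans[OF _ ntot])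
  moreover have "pot [[]] C = pot [] C * a []" unfolding pot_def below by simp
  ultimately show ?thesis using True a_pos[of "[]"] by (simp add: epot_def ennreal_mult'' less_imp_le)
next
  case False
  then show ?thesis using a_pos[of "[]"] by (simp add: epot_def ennreal_top_mult)
qed

lemma nn_integral_epot_split_config:
  "(\<integral>\<^sup>+ C. epot [] C \<partial>measure_spmf (split_config b s s0 s1 \<omega> n)) \<le> ennreal (a [] ^ n)"
proof (induction n)
  case 0
  have "wf_state b s s1 [] (\<lambda>_. 0)" by (simp add: wf_state_def below_def)
  moreover have "pot [] (\<lambda>_. 0) = 1" by (simp add: pot_def ball_prod_def below_def)
  ultimately show ?case by (simp add: epot_def measure_spmf_return_spmf nn_integral_return)
next
  case (Suc n)
  have "(\<integral>\<^sup>+ C. epot [] C \<partial>measure_spmf (split_config b s s0 s1 \<omega> (Suc n))) \<le>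
      (\<integral>\<^sup>+ C. epot [] C * ennreal (a []) \<partial>measure_spmf (split_config b s s0 s1 \<omega> n))"
    by (simp add: nn_integral_bind_spmf)
       (intro nn_integral_mono order_trans[OF nn_integral_epot_ins_balls epot_insert])
  also have "\<dots> = (\<integral>\<^sup>+ C. epot [] C \<partial>measure_spmf (split_config b s s0 s1 \<omega> n)) * ennreal (a [])"
    by (simp add: nn_integral_multc)
  also have "\<dots> \<le> ennreal (a [] ^ n) * ennreal (a [])"
    by (intro mult_right_mono Suc) simp
  also have "\<dots> = ennreal (a [] ^ Suc n)"
    using a_pos[of "[]"] by (simp add: ennreal_mult' mult.commute)
  finally show ?case .
qed

end

section \<open>Hitting probabilities and the tail bound for one subtree\<close>

definition words :: "nat \<Rightarrow> nat \<Rightarrow> nat list set" where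
  "words b d = {v. set v \<subseteq> {..<b} \<and> length v = d}"

definition path_weight :: "(nat list \<Rightarrow> nat \<Rightarrow> real) \<Rightarrow> nat list \<Rightarrow> real" where
  "path_weight \<omega> t = (\<Prod>j<length t. \<omega> (take j t) (t ! j))"

text \<open>The probability that a ball arriving at \<open>w\<close> passes through \<open>t\<close>, if all its steps are
  random.\<close>

definition hit_prob :: "(nat list \<Rightarrow> nat \<Rightarrow> real) \<Rightarrow> nat list \<Rightarrow> nat list \<Rightarrow> real" where
  "hit_prob \<omega> t w = (if prefix w t then \<Prod>j\<in>{length w..<length t}. \<omega> (take j t) (t ! j)
     else if prefix t w then 1 else 0)"

lemma hit_prob_Nil: "hit_prob \<omega> t [] = path_weight \<omega> t"
  by (simp add: hit_prob_def path_weight_def atLeast0LessThan)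

lemma hit_prob_below: "prefix t w \<Longrightarrow> hit_prob \<omega> t w = 1"
  by (auto simp: hit_prob_def dest: prefix_order.antisym)

lemma simplex_vec_le_1:
  assumes "simplex_vec b w" "i < b" shows "w i \<le> 1"
proof -
  have "w i = (\<Sum>j\<in>{i}. w j)" by simp
  also have "\<dots> \<le> (\<Sum>j<b. w j)" using assms by (intro sum_mono2) (auto simp: simplex_vec_def)
  finally show ?thesis using assms by (simp add: simplex_vec_def)
qed

lemma strict_prefix_nth:
  assumes "strict_prefix u t"
  shows "length u < length t" "take (length u) t = u" "prefix (u @ [i]) t \<longleftrightarrow> i = t ! length u"
proof -
  obtain x xs where t: "t = u @ x # xs" using assms by (auto elim: strict_prefixE')
  then show "length u < length t" "take (length u) t = u" "prefix (u @ [i]) t \<longleftrightarrow> i = t ! length u"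
    by auto
qed

context
  fixes b :: nat and \<omega> :: "nat list \<Rightarrow> nat \<Rightarrow> real" and t :: "nat list"
  assumes simplex: "\<And>u. simplex_vec b (\<omega> u)" and t: "set t \<subseteq> {..<b}"
begin

lemma step_bounds:
  assumes "j < length t"
  shows "0 \<le> \<omega> (take j t) (t ! j)" "\<omega> (take j t) (t ! j) \<le> 1"
proof -
  have "t ! j < b" using assms t nth_mem by fastforce
  then show "0 \<le> \<omega> (take j t) (t ! j)" "\<omega> (take j t) (t ! j) \<le> 1"
    using simplex[of "take j t"] simplex_vec_le_1 by (auto simp: simplex_vec_def)
qed

lemma hit_prob_bounds: "0 \<le> hit_prob \<omega> t w" "hit_prob \<omega> t w \<le> 1"
  unfolding hit_prob_def using step_bounds by (auto intro!: prod_nonneg prod_le_1)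

lemma path_weight_bounds: "0 \<le> path_weight \<omega> t" "path_weight \<omega> t \<le> 1"
  using hit_prob_bounds[of "[]"] by (simp_all add: hit_prob_Nil)

lemma hit_prob_step:
  assumes "strict_prefix u t"
  shows "hit_prob \<omega> t u = hit_prob \<omega> t (u @ [t ! length u]) * \<omega> u (t ! length u)"
    and "i \<noteq> t ! length u \<Longrightarrow> hit_prob \<omega> t (u @ [i]) = 0"
proof -
  note S = strict_prefix_nth[OF assms]
  have "{length u..<length t} = insert (length u) {Suc (length u)..<length t}"
    using S(1) by auto
  then show "hit_prob \<omega> t u = hit_prob \<omega> t (u @ [t ! length u]) * \<omega> u (t ! length u)"
    unfolding hit_prob_def using assms S by (simp add: strict_prefix_def)
  assume "i \<noteq> t ! length u"
  then have np: "\<not> prefix (u @ [i]) t" using S(3) by simp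
  have "\<not> prefix t (u @ [i])"
  proof
    assume p: "prefix t (u @ [i])"
    then obtain zs where zs: "u @ [i] = t @ zs" by (auto simp: prefix_def)
    from arg_cong[OF this, of length] have "Suc (length u) = length t + length zs" by simp
    with S(1) have "length zs = 0" by linarith
    with zs have "t = u @ [i]" by simp
    with np show False by simp
  qed
  with np show "hit_prob \<omega> t (u @ [i]) = 0" by (simp add: hit_prob_def)
qed

lemma hit_prob_off_path:
  assumes "\<not> strict_prefix u t"
  shows "hit_prob \<omega> t (u @ [i]) = hit_prob \<omega> t u"
proof (cases "prefix t u")
  case True
  then show ?thesis by (simp add: hit_prob_below)
next
  case False
  have "\<not> prefix u t" using assms False by (auto simp: strict_prefix_def)
  moreover have "\<not> prefix (u @ [i]) t" using calculation by (auto dest: append_prefixD)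
  moreover have "\<not> prefix t (u @ [i])" using False calculation by auto
  ultimately show ?thesis using False by (simp add: hit_prob_def)
qed

text \<open>First-step analysis: on the path to \<open>t\<close> a single child counts, and off the
  path the hitting probability is the same at all children. This is the harmonicity that the
  martingale needs.\<close>

lemma sum_hit_prob: "(\<Sum>i<b. hit_prob \<omega> t (u @ [i]) * \<omega> u i) = hit_prob \<omega> t u"
proof (cases "strict_prefix u t")
  case True
  let ?k = "t ! length u"
  have k: "?k < b" using strict_prefix_nth(1)[OF True] t nth_mem by fastforce
  have "(\<Sum>i<b. hit_prob \<omega> t (u @ [i]) * \<omega> u i) = (\<Sum>i\<in>{?k}. hit_prob \<omega> t (u @ [i]) * \<omega> u i)"
    using k hit_prob_step(2)[OF True] by (intro sum.mono_neutral_right) auto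
  then show ?thesis using hit_prob_step(1)[OF True] by simp
next
  case False
  then show ?thesis using simplex[of u]
    by (simp add: hit_prob_off_path sum_distrib_left[symmetric] simplex_vec_def)
qed

context
  fixes s s0 s1 :: nat and z :: real
  assumes params: "b \<ge> 2" "s \<ge> 1" "s0 \<le> s" "b * s1 \<le> s + 1 - s0" and z: "z > 0"
begin

interpretation H: harmonic_weight b s s0 s1 \<omega> t "\<lambda>w. 1 + z * hit_prob \<omega> t w"
proof
  show "0 < 1 + z * hit_prob \<omega> t u" for u using z hit_prob_bounds[of u] by (simp add: add_pos_nonneg)
  show "(\<Sum>i<b. (1 + z * hit_prob \<omega> t (u @ [i])) * \<omega> u i) = 1 + z * hit_prob \<omega> t u" for u
  proof -
    have "(\<Sum>i<b. (1 + z * hit_prob \<omega> t (u @ [i])) * \<omega> u i) =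
        (\<Sum>i<b. \<omega> u i) + z * (\<Sum>i<b. hit_prob \<omega> t (u @ [i]) * \<omega> u i)"
      by (simp add: algebra_simps sum.distrib sum_distrib_left)
    then show ?thesis using simplex[of u] by (simp add: sum_hit_prob simplex_vec_def)
  qed
qed (use params simplex hit_prob_off_path in auto)

text \<open>Children off the path have hitting probability 0 and weight 1, so a single factor
  remains in the denominator of \<open>forced\<close>; in the numerator, \<open>b\<close> factors
  are at least one factor because the weight is at least 1.\<close>

lemma forced_ge:
  assumes "strict_prefix u t"
  shows "((1 + z * hit_prob \<omega> t u) / (1 + z * hit_prob \<omega> t (u @ [t ! length u]))) ^ s1 \<le> H.forced u"
proof -
  let ?k = "t ! length u" and ?a = "\<lambda>w. 1 + z * hit_prob \<omega> t w"
  have k: "?k < b" using strict_prefix_nth(1)[OF assms] t nth_mem by fastforce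
  have "(\<Prod>i<b. ?a (u @ [i])) = (\<Prod>i\<in>{?k}. ?a (u @ [i]))"
    using k hit_prob_step(2)[OF assms] by (intro prod.mono_neutral_right) auto
  then have eq: "(\<Prod>i<b. ?a (u @ [i])) = ?a (u @ [?k])" by simp
  have "?a u \<le> ?a u ^ b"
    using z hit_prob_bounds[of u] params by (intro self_le_power) auto
  then show ?thesis unfolding H.forced_def eq
    using H.a_pos[of u] H.a_pos[of "u @ [?k]"] by (intro power_mono divide_right_mono) auto
qed

text \<open>Weights grow along the path, so every ratio \<open>r j / r (Suc j)\<close> is at most 1.
  Extending the product from the split vertices \<open>J\<close> to all strict prefixes therefore
  only lowers it, and then it telescopes to \<open>r 0 / r (length t)\<close> with
  \<open>r 0\<close> \<ge> 1 and \<open>r (length t) = 1 + z\<close>.\<close>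

lemma prod_forced_ge:
  "(1 / (1 + z)) ^ s1 \<le> (\<Prod>u\<in>{u. strict_prefix u t \<and> P u}. H.forced u)"
proof -
  define r where "r j = 1 + z * hit_prob \<omega> t (take j t)" for j
  define J where "J = {j. j < length t \<and> P (take j t)}"
  have r1: "r j \<ge> 1" for j using z hit_prob_bounds[of "take j t"] by (simp add: r_def)
  have r0: "r j > 0" for j using r1[of j] by simp
  have sp: "strict_prefix (take j t) t" if "j < length t" for j
    using that by (auto simp: strict_prefix_def take_is_prefix dest: arg_cong[of _ _ length])
  have r_Suc: "r j = 1 + z * hit_prob \<omega> t (take (Suc j) t) * \<omega> (take j t) (t ! j)"
     "r (Suc j) = 1 + z * hit_prob \<omega> t (take j t @ [t ! j])" if "j < length t" for j
    using hit_prob_step(1)[OF sp[OF that]] that by (simp_all add: r_def take_Suc_conv_app_nth min_def)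
  have mono: "r j \<le> r (Suc j)" if "j < length t" for j
    unfolding r_Suc(1)[OF that] using step_bounds[OF that] hit_prob_bounds[of "take (Suc j) t"] z
    by (simp add: r_def mult_left_le mult.assoc)
  have "{u. strict_prefix u t \<and> P u} = (\<lambda>j. take j t) ` J"
    unfolding J_def using sp strict_prefix_nth(1,2) by (force simp: image_def)
  moreover have "inj_on (\<lambda>j. take j t) J"
    unfolding J_def by (rule inj_onI) (auto dest!: arg_cong[of _ _ length])
  ultimately have "(\<Prod>u\<in>{u. strict_prefix u t \<and> P u}. H.forced u) = (\<Prod>j\<in>J. H.forced (take j t))"
    by (simp add: prod.reindex)
  moreover have "(\<Prod>j\<in>J. (r j / r (Suc j)) ^ s1) \<le> (\<Prod>j\<in>J. H.forced (take j t))"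
  proof (intro prod_mono conjI)
    fix j assume j: "j \<in> J"
    show "0 \<le> (r j / r (Suc j)) ^ s1" using r0[of j] r0[of "Suc j"] by simp
    show "(r j / r (Suc j)) ^ s1 \<le> H.forced (take j t)"
      using forced_ge[OF sp, of j] j unfolding J_def by (simp add: take_Suc_conv_app_nth r_def min_def)
  qed
  moreover have "(\<Prod>j<length t. (r j / r (Suc j)) ^ s1) \<le> (\<Prod>j\<in>J. (r j / r (Suc j)) ^ s1)"
  proof -
    have "(\<Prod>j<length t. (r j / r (Suc j)) ^ s1) =
        (\<Prod>j\<in>{..<length t} - J. (r j / r (Suc j)) ^ s1) * (\<Prod>j\<in>J. (r j / r (Suc j)) ^ s1)"
      by (rule prod.subset_diff) (auto simp: J_def)
    also have "\<dots> \<le> 1 * (\<Prod>j\<in>J. (r j / r (Suc j)) ^ s1)"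
      using r0[THEN less_imp_le] mono r0
      by (intro mult_right_mono prod_le_1 prod_nonneg) (auto intro!: power_le_one simp: divide_le_eq_1)
    finally show ?thesis by simp
  qed
  moreover have "(\<Prod>j<n. (r j / r (Suc j)) ^ s1) = (r 0 / r n) ^ s1" for n
  proof (induction n)
    case 0
    show ?case using r0[of 0] by simp
  next
    case (Suc n)
    then show ?case using r0[of n] by (simp add: power_mult_distrib[symmetric])
  qed
  moreover have "(1 / (1 + z)) ^ s1 \<le> (r 0 / r (length t)) ^ s1"
    using z r1[of 0] by (intro power_mono divide_right_mono frac_le) (auto simp: r_def hit_prob_below)
  ultimately show ?thesis by simp
qed

text \<open>Each ball below \<open>t\<close> weighs \<open>1 + z\<close> and every other ball at
  least 1; the surplus of \<open>s1\<close> balls pays for the factors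
  \<open>forced\<close>.\<close>

lemma pot_ge:
  assumes wf: "wf_state b s s1 [] C" and ge: "nsub C t \<ge> k + s1"
  shows "(1 + z) ^ k \<le> H.pot [] C"
proof -
  let ?a = "\<lambda>w. 1 + z * hit_prob \<omega> t w"
  have fin: "finite {w. C w \<noteq> 0}" using wf by (simp add: wf_state_def)
  have a1: "?a w \<ge> 1" for w using z hit_prob_bounds[of w] by simp
  have "(1 + z) ^ nsub C t = (\<Prod>w\<in>{w. prefix t w \<and> C w \<noteq> 0}. ?a w ^ C w)"
    unfolding nsub_def power_sum by (intro prod.cong) (auto simp: hit_prob_below)
  also have "\<dots> \<le> ball_prod ?a C"
    unfolding ball_prod_def using a1 fin by (intro prod_mono2) (auto simp: less_imp_le order_trans[OF zero_le_one a1])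
  finally have 1: "(1 + z) ^ nsub C t \<le> ball_prod ?a C" .
  have "(1 + z) ^ k = (1 + z) ^ (k + s1) * (1 / (1 + z)) ^ s1"
    using z by (simp add: power_add power_divide)
  also have "\<dots> \<le> (1 + z) ^ nsub C t * (1 / (1 + z)) ^ s1"
    using z ge by (intro mult_right_mono power_increasing) auto
  also have "\<dots> \<le> ball_prod ?a C * (\<Prod>u\<in>{u. strict_prefix u t \<and> below [] C u}. H.forced u)"
  proof (intro mult_mono prod_forced_ge 1)
    have "0 \<le> (1 + z) ^ nsub C t" using z by simp
    also note 1
    finally show "0 \<le> ball_prod ?a C" .
  qed (use z in auto)
  finally show ?thesis by (simp add: H.pot_def)
qed

text \<open>Markov's inequality for \<open>epot\<close>: on the event the grandparent
  \<open>t\<close> holds \<open>s + 1 + s1\<close> balls, at least \<open>2 + s1\<close> since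
  \<open>s\<close> \<ge> 1, so the potential is at least \<open>(1 + z)^2\<close>. States outside
  the invariant are covered by the value infinity.\<close>

lemma emeasure_subtree_exp:
  assumes i: "i < b"
  shows "emeasure (measure_spmf (split_config b s s0 s1 \<omega> n)) {C. t @ [i, j] \<in> tree_vertices C} *
     ennreal ((1 + z)\<^sup>2) \<le> ennreal ((1 + z * path_weight \<omega> t) ^ n)"
proof -
  let ?M = "measure_spmf (split_config b s s0 s1 \<omega> n)"
  have "emeasure ?M {C. t @ [i, j] \<in> tree_vertices C} * ennreal ((1 + z)\<^sup>2) =
      (\<integral>\<^sup>+ C. indicator {C. t @ [i, j] \<in> tree_vertices C} C * ennreal ((1 + z)\<^sup>2) \<partial>?M)"
    by (simp add: nn_integral_multc)
  also have "\<dots> \<le> (\<integral>\<^sup>+ C. H.epot [] C \<partial>?M)"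
  proof (intro nn_integral_mono)
    fix C
    show "indicator {C. t @ [i, j] \<in> tree_vertices C} C * ennreal ((1 + z)\<^sup>2) \<le> H.epot [] C"
    proof (cases "wf_state b s s1 [] C \<and> t @ [i, j] \<in> tree_vertices C")
      case True
      then have "nsub C t \<ge> s + 1 + s1"
        using nsub_grandparent_ge[OF _ params(1) i] by (auto simp: tree_vertices_def)
      then have "(1 + z)\<^sup>2 \<le> H.pot [] C" using params True by (intro pot_ge) auto
      then show ?thesis using True by (simp add: H.epot_def ennreal_leI)
    qed (auto simp: H.epot_def split: split_indicator)
  qed
  also have "\<dots> \<le> ennreal ((1 + z * path_weight \<omega> t) ^ n)"
    using H.nn_integral_epot_split_config[of n] by (simp add: hit_prob_Nil)
  finally show ?thesis .
qed

text \<open>\<open>epot\<close> has finite mean, hence is almost surely finite. The conclusion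
  concerns \<open>C\<close> alone, so \<open>t\<close> and \<open>z\<close> are auxiliary.\<close>

lemma AE_wf_state: "AE C in measure_spmf (split_config b s s0 s1 \<omega> n). wf_state b s s1 [] C"
proof -
  have "(\<integral>\<^sup>+ C. H.epot [] C \<partial>measure_spmf (split_config b s s0 s1 \<omega> n)) \<noteq> \<infinity>"
    using H.nn_integral_epot_split_config[of n] by (auto simp: top_unique)
  then have "AE C in measure_spmf (split_config b s s0 s1 \<omega> n). H.epot [] C \<noteq> \<infinity>"
    by (intro nn_integral_noteq_infinite) auto
  then show ?thesis by eventually_elim (auto simp: H.epot_def split: if_splits)
qed

end

text \<open>With x = n L and z = 1 / x, the numerator (1 + 1/n)^n is at most e, and 1 / (1 + 1/x)^2
  is at most both 1 and x^2. One of these two is at most x^\<theta>, according to whether x \<ge>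
  1.\<close>

lemma measure_subtree_le:
  fixes s s0 s1 n :: nat and \<theta> :: real
  assumes params: "b \<ge> 2" "s \<ge> 1" "s0 \<le> s" "b * s1 \<le> s + 1 - s0" and i: "i < b"
    and n: "n > 0" and \<theta>: "0 \<le> \<theta>" "\<theta> \<le> 2"
  shows "measure (measure_spmf (split_config b s s0 s1 \<omega> n)) {C. t @ [i, j] \<in> tree_vertices C} \<le>
    exp 1 * (real n * path_weight \<omega> t) powr \<theta>"
proof -
  define p where "p = measure (measure_spmf (split_config b s s0 s1 \<omega> n)) {C. t @ [i, j] \<in> tree_vertices C}"
  define L where "L = path_weight \<omega> t"
  have L: "L \<ge> 0" unfolding L_def by (rule path_weight_bounds)
  have p: "p \<ge> 0" unfolding p_def by simp
  have main: "p * (1 + z)\<^sup>2 \<le> (1 + z * L) ^ n" if "z > 0" for z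
    using emeasure_subtree_exp[OF params that i, of n j] p L that
    by (simp add: measure_spmf.emeasure_eq_measure p_def[symmetric] L_def[symmetric] ennreal_mult[symmetric])
  show ?thesis
  proof (cases "L = 0")
    case True
    have "p = 0"
    proof (rule ccontr)
      assume "p \<noteq> 0"
      with p have "p > 0" by simp
      \<comment> \<open>For \<open>L = 0\<close> the inequality reads \<open>p * (1 + z)^2\<close>
        \<le> 1 for every positive \<open>z\<close>; \<open>z = 1 / p\<close> already contradicts
        it.\<close>
      with main[of "1 / p"] True have "p * (1 + 1 / p)\<^sup>2 \<le> 1" by simp
      moreover have "p * (1 + 1 / p)\<^sup>2 = p + 2 + 1 / p"
        using \<open>p > 0\<close> by (simp add: power2_eq_square field_simps)
      moreover have "1 / p > 0" using \<open>p > 0\<close> by simp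
      ultimately show False using \<open>p > 0\<close> by linarith
    qed
    then show ?thesis by (simp add: p_def)
  next
    case False
    define x where "x = real n * L"
    have x: "x > 0" using n L False by (simp add: x_def)
    have "p * (1 + 1 / x)\<^sup>2 \<le> (1 + 1 / real n) ^ n"
      using main[of "1 / x"] x n False by (simp add: x_def)
    also have "\<dots> \<le> exp 1"
    proof -
      have "(1 + 1 / real n) ^ n \<le> exp (1 / real n) ^ n"
        by (intro power_mono exp_ge_add_one_self) (auto intro: add_nonneg_nonneg)
      also have "\<dots> = exp 1" using n by (simp add: exp_of_nat_mult[symmetric])
      finally show ?thesis .
    qed
    finally have "p \<le> exp 1 / (1 + 1 / x)\<^sup>2" using x by (simp add: field_simps add_pos_pos)
    also have "1 / (1 + 1 / x)\<^sup>2 \<le> x powr \<theta>"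
    proof (cases "x \<ge> 1")
      case True
      have "1 / (1 + 1 / x)\<^sup>2 \<le> 1" using x by (simp add: divide_le_eq_1 one_le_power add_pos_pos)
      also have "1 \<le> x powr \<theta>" using True \<theta> by (simp add: ge_one_powr_ge_zero)
      finally show ?thesis .
    next
      case False
      have "1 / (1 + 1 / x)\<^sup>2 \<le> 1 / (1 / x)\<^sup>2"
        using x by (intro divide_left_mono power_mono mult_pos_pos zero_less_power) (auto intro: add_pos_pos)
      also have "\<dots> = x powr 2" using x by (simp add: power_divide)
      also have "\<dots> \<le> x powr \<theta>" using x False \<theta> by (intro powr_mono') auto
      finally show ?thesis .
    qed
    then have "exp 1 / (1 + 1 / x)\<^sup>2 \<le> exp 1 * x powr \<theta>"
      using mult_left_mono[of "1 / (1 + 1 / x)\<^sup>2" "x powr \<theta>" "exp 1"] by simp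
    finally show ?thesis by (simp add: p_def x_def L_def)
  qed
qed

end

section \<open>Estimates for powers and exponentials\<close>

lemma exp_le_quadratic: "exp (w::real) \<le> 1 + w + w\<^sup>2 / 2 * exp \<bar>w\<bar>"
proof -
  obtain t where t: "\<bar>t\<bar> \<le> \<bar>w\<bar>" "exp w = (\<Sum>m<2. w ^ m / fact m) + exp t / fact 2 * w ^ 2"
    using Maclaurin_exp_le[of w 2] by blast
  have "exp t \<le> exp \<bar>w\<bar>" using t(1) by simp
  then have "exp t * w\<^sup>2 \<le> exp \<bar>w\<bar> * w\<^sup>2" by (rule mult_right_mono) simp
  then show ?thesis using t(2) by (simp add: numeral_2_eq_2 field_simps)
qed

text \<open>With x = exp(-s), this is the second-order expansion of exp(-\<delta> s), multiplied by
  x. As \<bar>\<delta>\<bar> \<le> 1/2, the remainder factor exp(s/2) uses up only half of the decay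
  of x, and s^2/2 exp(-s/2) \<le> 4 bounds the error uniformly in x.\<close>

lemma powr_le_quadratic:
  fixes x \<delta> :: real
  assumes x: "0 \<le> x" "x \<le> 1" and \<delta>: "\<bar>\<delta>\<bar> \<le> 1 / 2"
  shows "x powr (1 + \<delta>) \<le> x - \<delta> * (- x * ln x) + 4 * \<delta>\<^sup>2"
proof (cases "x = 0")
  case False
  with x have x0: "x > 0" by simp
  define s where "s = - ln x"
  have s: "s \<ge> 0" using x x0 by (simp add: s_def)
  have xs: "x = exp (- s)" using x0 by (simp add: s_def)
  have "s\<^sup>2 / 8 \<le> exp (s / 2)"
    using exp_lower_Taylor_quadratic[of "s / 2"] s by (simp add: power_divide)
  then have s2: "s\<^sup>2 / 2 * exp (- (s / 2)) \<le> 4"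
    by (simp add: exp_minus field_simps)
  have "x powr (1 + \<delta>) = x * exp (- (\<delta> * s))"
    using x0 by (simp add: powr_def s_def algebra_simps exp_add)
  also have "\<dots> \<le> x * (1 + - (\<delta> * s) + (- (\<delta> * s))\<^sup>2 / 2 * exp \<bar>- (\<delta> * s)\<bar>)"
    using x by (intro mult_left_mono exp_le_quadratic) auto
  also have "\<dots> \<le> x * (1 + - (\<delta> * s) + (- (\<delta> * s))\<^sup>2 / 2 * exp (s / 2))"
  proof -
    have "\<bar>\<delta>\<bar> * s \<le> 1 / 2 * s" using \<delta> s by (intro mult_right_mono) auto
    then have "\<bar>- (\<delta> * s)\<bar> \<le> s / 2" using s by (simp add: abs_mult)
    then show ?thesis using x by (intro mult_left_mono add_left_mono) auto
  qed
  also have "\<dots> = x - \<delta> * (x * s) + \<delta>\<^sup>2 * (s\<^sup>2 / 2 * (x * exp (s / 2)))"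
    by (simp add: algebra_simps power_mult_distrib)
  also have "x * exp (s / 2) = exp (- (s / 2))"
    by (simp add: xs exp_add[symmetric])
  also have "\<delta>\<^sup>2 * (s\<^sup>2 / 2 * exp (- (s / 2))) \<le> \<delta>\<^sup>2 * 4"
    by (intro mult_left_mono s2) simp
  finally show ?thesis by (simp add: s_def algebra_simps)
qed simp

lemma powr_le_exp:
  fixes p \<kappa> x :: real
  assumes "p > 0" "\<kappa> > 0" "x > 0"
  shows "x powr p \<le> (p / \<kappa>) powr p * exp (\<kappa> * x)"
proof -
  have "\<kappa> * x / p \<le> exp (\<kappa> * x / p)" using exp_ge_add_one_self[of "\<kappa> * x / p"] by linarith
  then have "(\<kappa> * x / p) powr p \<le> exp (\<kappa> * x / p) powr p"
    using assms by (intro powr_mono2) auto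
  also have "\<dots> = exp (\<kappa> * x)" using assms by (simp add: powr_def)
  finally have "(p / \<kappa>) powr p * (\<kappa> * x / p) powr p \<le> (p / \<kappa>) powr p * exp (\<kappa> * x)"
    by (intro mult_left_mono) auto
  also have "(p / \<kappa>) powr p * (\<kappa> * x / p) powr p = x powr p"
    using assms by (simp add: powr_mult[symmetric])
  finally show ?thesis .
qed

lemma sums_geometric_from:
  fixes r :: real
  assumes "0 \<le> r" "r < 1"
  shows "(\<lambda>d. if h \<le> d then Y * r ^ (d - h) else 0) sums (Y / (1 - r))"
proof -
  have "(\<lambda>d. Y * r ^ d) sums (Y * (1 / (1 - r)))"
    using assms by (intro sums_mult geometric_sums) auto
  then have "(\<lambda>d. if h \<le> d + h then Y * r ^ (d + h - h) else 0) sums (Y / (1 - r))" by simp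
  then show ?thesis by (subst (asm) sums_zero_iff_shift) auto
qed

lemma geometric_rate_bound:
  fixes \<rho> :: real
  assumes "\<rho> > 0"
  shows "1 / (1 - exp (- \<rho>)) \<le> 1 + 1 / \<rho>"
proof -
  have "1 + \<rho> \<le> exp \<rho>" by simp
  then have "exp (- \<rho>) \<le> 1 / (1 + \<rho>)" using assms by (simp add: exp_minus field_simps)
  then have "\<rho> / (1 + \<rho>) \<le> 1 - exp (- \<rho>)" using assms by (simp add: field_simps)
  then have "1 / (1 - exp (- \<rho>)) \<le> 1 / (\<rho> / (1 + \<rho>))"
    using assms by (intro divide_left_mono mult_pos_pos) auto
  also have "\<dots> = 1 + 1 / \<rho>" using assms by (simp add: field_simps)
  finally show ?thesis .
qed


section \<open>The size of the exponent shift for depths outside the window\<close>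

text \<open>Here \<open>L\<close> is ln n, and \<open>c\<close> is the constant in b E V^(1 +
  \<delta>) \<le> exp(- \<mu> \<delta> + c \<delta>^2). The bounds on \<eta> serve in turn the
  moment expansion, the rate \<open>\<rho>\<close> \<ge> \<open>\<mu> * \<delta> / 2\<close>, and a
  quadratic error of at most \<open>\<mu> * \<eta> * q / 4\<close>.\<close>

locale deviation =
  fixes \<mu> c \<eta> \<epsilon> L :: real
  assumes \<mu>: "\<mu> > 0" and c: "c > 0" and \<epsilon>: "\<epsilon> > 0" and L: "L \<ge> 1"
    and \<eta>: "\<eta> > 0" "\<eta> \<le> 1 / 2" "\<eta> \<le> \<mu> / (2 * c)" "\<eta> \<le> \<mu>\<^sup>2 / (4 * c)"
begin

text \<open>The cap keeps the exponent of \<open>L\<close> in \<delta> negative. It loses nothing: a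
  depth outside the window of \<epsilon> is also outside the narrower window of half-width
  \<open>w\<close>.\<close>

definition \<epsilon>' :: real where "\<epsilon>' = min \<epsilon> (1 / 4)"
text \<open>Leaving the window gains order \<delta> w in the exponent, while the quadratic term
  costs order \<delta>^2 L. This power of \<open>L\<close> turns them into \<eta> q and \<eta>^2 q,
  so a small \<eta> lets the gain win.\<close>

definition \<delta> :: real where "\<delta> = \<eta> * L powr (\<epsilon>' - 1 / 2)"
definition \<rho> :: real where "\<rho> = \<mu> * \<delta> - c * \<delta>\<^sup>2"
definition q :: real where "q = L powr (2 * \<epsilon>')"
definition w :: real where "w = L powr (1 / 2 + \<epsilon>')"

lemma \<epsilon>': "\<epsilon>' > 0" "\<epsilon>' \<le> 1 / 4" "\<epsilon>' \<le> \<epsilon>"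
  using \<epsilon> by (auto simp: \<epsilon>'_def)

lemma \<delta>_pos: "\<delta> > 0"
  using \<eta> L by (simp add: \<delta>_def)

lemma \<delta>_le: "\<delta> \<le> \<eta>"
proof -
  have "L powr (\<epsilon>' - 1 / 2) \<le> L powr 0" using L \<epsilon>' by (intro powr_mono) auto
  then show ?thesis using L \<eta> by (simp add: \<delta>_def mult_left_le)
qed

lemma \<rho>_ge: "\<mu> * \<delta> / 2 \<le> \<rho>"
proof -
  have "c * \<delta> \<le> c * (\<mu> / (2 * c))" using \<delta>_le \<eta>(3) c by (intro mult_left_mono) auto
  then have "c * \<delta> \<le> \<mu> / 2" using c by simp
  then have "c * \<delta> * \<delta> \<le> \<mu> / 2 * \<delta>" using \<delta>_pos by (intro mult_right_mono) auto
  then show ?thesis by (simp add: \<rho>_def power2_eq_square algebra_simps)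
qed

lemma \<rho>_le: "\<rho> \<le> \<mu>"
proof -
  have "\<rho> \<le> \<mu> * \<delta>" using c by (simp add: \<rho>_def)
  also have "\<dots> \<le> \<mu> * 1" using \<mu> \<delta>_le \<eta> by (intro mult_left_mono) auto
  finally show ?thesis by simp
qed

lemma \<rho>_pos: "\<rho> > 0"
  using \<rho>_ge \<mu> \<delta>_pos by (meson half_gt_zero less_le_trans mult_pos_pos)

lemma \<delta>_w: "\<delta> * w = \<eta> * q"
  by (simp add: \<delta>_def w_def q_def mult.assoc powr_add[symmetric])

lemma \<delta>_sq: "\<delta>\<^sup>2 * L = \<eta>\<^sup>2 * q"
proof -
  have "(L powr (\<epsilon>' - 1 / 2))\<^sup>2 * L = L powr (\<epsilon>' - 1 / 2) * L powr (\<epsilon>' - 1 / 2) * L powr 1"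
    using L by (simp add: power2_eq_square)
  also have "\<dots> = q" unfolding q_def powr_add[symmetric] by simp
  finally show ?thesis by (simp add: \<delta>_def power_mult_distrib mult.assoc)
qed

lemma w_le: "w \<le> L powr (1 / 2 + \<epsilon>)"
  unfolding w_def using L \<epsilon>' by (intro powr_mono) auto

lemma error_le: "c * \<delta>\<^sup>2 * L / \<mu> \<le> \<mu> * \<eta> * q / 4"
proof -
  have "c * \<eta> \<le> c * (\<mu>\<^sup>2 / (4 * c))" using \<eta>(4) c by (intro mult_left_mono) auto
  then have "c * \<eta> \<le> \<mu>\<^sup>2 / 4" using c by simp
  then have "c * \<eta> * (\<eta> * q / \<mu>) \<le> \<mu>\<^sup>2 / 4 * (\<eta> * q / \<mu>)"
    using \<eta>(1) \<mu> by (intro mult_right_mono) (auto simp: q_def)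
  moreover have "c * \<delta>\<^sup>2 * L / \<mu> = c * \<eta> * (\<eta> * q / \<mu>)"
  proof -
    have "c * \<delta>\<^sup>2 * L / \<mu> = c * (\<delta>\<^sup>2 * L) / \<mu>" by (simp only: mult.assoc)
    then show ?thesis unfolding \<delta>_sq by (simp add: power2_eq_square mult_ac)
  qed
  moreover have "\<mu>\<^sup>2 / 4 * (\<eta> * q / \<mu>) = \<mu> * \<eta> * q / 4"
    using \<mu> by (simp add: power2_eq_square)
  ultimately show ?thesis by (simp only:)
qed

text \<open>Up to depth L/\<mu> - w the growth d \<mu> \<delta> falls short of the saving \<delta> L
  by \<mu> \<delta> w = \<mu> \<eta> q, of which the quadratic error takes at most a quarter. The
  weaker final constant agrees with \<open>high_exponent\<close>.\<close>

lemma low_exponent: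
  assumes d: "0 \<le> d" "d \<le> L / \<mu> - L powr (1 / 2 + \<epsilon>)"
  shows "(1 - \<delta>) * L + d * (\<mu> * \<delta> + c * \<delta>\<^sup>2) \<le> L - \<mu> * \<eta> / 4 * q"
proof -
  have dw: "d \<le> L / \<mu> - w" using d w_le by simp
  have "d * (\<mu> * \<delta>) \<le> (L / \<mu> - w) * (\<mu> * \<delta>)"
    using dw \<mu> \<delta>_pos by (intro mult_right_mono) auto
  also have "\<dots> = \<delta> * L - \<mu> * (\<delta> * w)" using \<mu> by (simp add: field_simps)
  finally have 1: "d * (\<mu> * \<delta>) \<le> \<delta> * L - \<mu> * \<eta> * q" by (simp add: \<delta>_w)
  have "d \<le> L / \<mu>" using dw by (simp add: w_def) (meson add_increasing2 order_trans powr_ge_zero diff_le_eq le_add_same_cancel1)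
  then have "d * (c * \<delta>\<^sup>2) \<le> L / \<mu> * (c * \<delta>\<^sup>2)" using c by (intro mult_right_mono) auto
  then have 2: "d * (c * \<delta>\<^sup>2) \<le> \<mu> * \<eta> * q / 4" 
  proof -
    have "L / \<mu> * (c * \<delta>\<^sup>2) = c * \<delta>\<^sup>2 * L / \<mu>" by simp
    with \<open>d * (c * \<delta>\<^sup>2) \<le> L / \<mu> * (c * \<delta>\<^sup>2)\<close> error_le show ?thesis by linarith
  qed
  have "0 \<le> \<mu> * \<eta> * q" using \<mu> \<eta> by (simp add: q_def)
  then show ?thesis using 1 2 by (simp add: algebra_simps)
qed

text \<open>The decay over the first L/\<mu> levels cancels \<delta> L up to the quadratic error;
  the further w levels gain at least \<mu> \<delta> w / 2 = \<mu> \<eta> q / 2, twice the bound on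
  that error.\<close>

lemma high_exponent:
  assumes h: "L / \<mu> + L powr (1 / 2 + \<epsilon>) \<le> h"
  shows "(1 + \<delta>) * L - \<rho> * h \<le> L - \<mu> * \<eta> / 4 * q"
proof -
  have "\<rho> * (L / \<mu> + w) \<le> \<rho> * h" using h w_le \<rho>_pos by (intro mult_left_mono) auto
  moreover have "\<rho> * (L / \<mu>) = \<delta> * L - c * \<delta>\<^sup>2 * L / \<mu>"
    using \<mu> by (simp add: \<rho>_def field_simps)
  moreover have "\<mu> * \<delta> / 2 * w \<le> \<rho> * w" using \<rho>_ge by (intro mult_right_mono) (simp_all add: w_def)
  moreover have "\<mu> * \<delta> / 2 * w = \<mu> * \<eta> * q / 2" using \<delta>_w by simp
  moreover have "\<rho> * (L / \<mu> + w) = \<rho> * (L / \<mu>) + \<rho> * w" "(1 + \<delta>) * L = L + \<delta> * L"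
    "\<mu> * \<eta> / 4 * q = \<mu> * \<eta> * q / 4"
    by (simp_all add: distrib_left distrib_right)
  ultimately show ?thesis using error_le by linarith
qed

text \<open>Because \<open>\<delta>\<close> \<ge> \<open>\<eta> / L\<close>, summing the geometric
  series over all large depths costs only a factor of order \<open>L\<close>.\<close>

lemma rate_bound: "1 / (1 - exp (- \<rho>)) \<le> (1 + 2 / (\<mu> * \<eta>)) * L"
proof -
  have "L powr (-1) \<le> L powr (\<epsilon>' - 1 / 2)" using L \<epsilon>' by (intro powr_mono) auto
  then have "\<eta> / L \<le> \<delta>" using \<eta> L by (simp add: \<delta>_def powr_minus_divide mult_left_mono[of "1 / L" _ \<eta>, simplified])
  then have "\<mu> * (\<eta> / L) \<le> \<mu> * \<delta>" using \<mu> by (intro mult_left_mono) auto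
  then have "\<mu> * (\<eta> / L) / 2 \<le> \<mu> * \<delta> / 2"
    by (rule divide_right_mono) simp
  also note \<rho>_ge
  finally have "1 / \<rho> \<le> 1 / (\<mu> * (\<eta> / L) / 2)"
    using \<mu> \<eta> L \<rho>_pos by (intro divide_left_mono) auto
  also have "\<dots> = 2 / (\<mu> * \<eta>) * L" using L by (simp add: field_simps)
  finally show ?thesis
    using geometric_rate_bound[OF \<rho>_pos] L by (simp add: distrib_right)
qed

end

lemma powr_mult_exp_le:
  fixes L :: real
  assumes "k > 0" "\<kappa> > 0" "e > 0" "L > 0"
  shows "L powr k * exp (- \<kappa> * L powr e) \<le> (k / e / \<kappa>) powr (k / e)"
proof -
  have "L powr k = (L powr e) powr (k / e)" using assms by (simp add: powr_powr)
  also have "\<dots> \<le> (k / e / \<kappa>) powr (k / e) * exp (\<kappa> * L powr e)"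
    using assms by (intro powr_le_exp) auto
  finally show ?thesis by (simp add: exp_minus field_simps)
qed

section \<open>Averaging over the split vectors\<close>

lemma nsub_posD: "nsub C v > 0 \<Longrightarrow> \<exists>w. prefix v w \<and> C w \<noteq> 0"
  unfolding nsub_def by (metis (mono_tags, lifting) empty_Collect_eq neq0_conv sum.empty)

lemma finite_words: "finite (words b d)"
  unfolding words_def using finite_lists_length_eq[of "{..<b}" d] by simp

lemma card_words: "card (words b d) = b ^ d"
  unfolding words_def using card_lists_length_eq[of "{..<b}" d] by simp

text \<open>An infinite sum over all depths is used since the height of the tree has no fixed bound;
  monotone convergence then moves integrals inside.\<close>

lemma ennreal_card_words_le:
  assumes fin: "finite A" and sub: "\<And>v. v \<in> A \<Longrightarrow> set v \<subseteq> {..<b}"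
  shows "ennreal (real (card A)) \<le> (\<Sum>d. \<Sum>v\<in>words b d. indicator A v)"
proof -
  define D where "D = Suc (Max (insert 0 (length ` A)))"
  have D: "length v < D" if "v \<in> A" for v
    unfolding D_def using fin that by (auto simp: less_Suc_eq_le)
  have A: "A = (\<Union>d<D. words b d \<inter> A)" using D sub by (auto simp: words_def)
  have "card A = (\<Sum>d<D. card (words b d \<inter> A))"
    by (subst A, subst card_UN_disjoint) (auto simp: fin words_def)
  moreover have "ennreal (real (card A)) = of_nat (card A)"
    by (simp add: ennreal_of_nat_eq_real_of_nat)
  ultimately have "ennreal (real (card A)) = (\<Sum>d<D. \<Sum>v\<in>words b d. indicator A v)"
    by (simp add: indicator_def sum.If_cases finite_words
        Int_commute)
  also have "\<dots> \<le> (\<Sum>d. \<Sum>v\<in>words b d. indicator A v)"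
    by (intro sum_le_suminf) auto
  finally show ?thesis .
qed

text \<open>Projecting onto the finitely many coordinates in \<open>J\<close> reduces this to Fubini
  for a finite product. It expresses the independence of the split vectors along a path.\<close>

lemma (in product_prob_space) nn_integral_PiM_prod:
  assumes "finite J" "J \<subseteq> I" "\<And>i. i \<in> J \<Longrightarrow> f i \<in> borel_measurable (M i)"
  shows "(\<integral>\<^sup>+ x. (\<Prod>i\<in>J. f i (x i)) \<partial>PiM I M) = (\<Prod>i\<in>J. \<integral>\<^sup>+ x. f i x \<partial>M i)"
proof -
  have "(\<Prod>i\<in>J. \<integral>\<^sup>+ x. f i x \<partial>M i) = (\<integral>\<^sup>+ x. (\<Prod>i\<in>J. f i (x i)) \<partial>PiM J M)"
    using assms by (subst product_nn_integral_prod) auto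
  also have "\<dots> = (\<integral>\<^sup>+ x. (\<Prod>i\<in>J. f i (x i)) \<partial>distr (PiM I M) (PiM J M) (\<lambda>x. restrict x J))"
    using assms by (simp add: distr_PiM_restrict_finite)
  also have "\<dots> = (\<integral>\<^sup>+ x. (\<Prod>i\<in>J. f i (restrict x J i)) \<partial>PiM I M)"
    using assms by (intro nn_integral_distr) (auto intro!: borel_measurable_prod_ennreal measurable_restrict_subset)
  also have "\<dots> = (\<integral>\<^sup>+ x. (\<Prod>i\<in>J. f i (x i)) \<partial>PiM I M)"
    by (intro nn_integral_cong prod.cong) auto
  finally show ?thesis by simp
qed

locale split_law = prob_space Vlaw for Vlaw :: "(nat \<Rightarrow> real) measure" +
  fixes b :: nat
  assumes b: "b \<ge> 2"
    and sets_V: "sets Vlaw = sets (PiM {..<b} (\<lambda>_. borel))"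
    and simplex: "AE x in Vlaw. (\<forall>i<b. 0 \<le> x i) \<and> (\<Sum>i<b. x i) = 1"
    and ident: "\<forall>i<b. distr Vlaw borel (\<lambda>x. x i) = distr Vlaw borel (\<lambda>x. x 0)"
begin

abbreviation env :: "(nat list \<Rightarrow> nat \<Rightarrow> real) measure" where
  "env \<equiv> PiM (UNIV :: nat list set) (\<lambda>_. Vlaw)"

definition moment :: "real \<Rightarrow> real" where
  "moment \<theta> = (\<integral>x. x 0 powr \<theta> \<partial>Vlaw)"

lemma measurable_component: "i < b \<Longrightarrow> (\<lambda>x. x i) \<in> borel_measurable Vlaw"
  unfolding measurable_cong_sets[OF sets_V refl] by (rule measurable_component_singleton) simp

lemma AE_component: "i < b \<Longrightarrow> AE x in Vlaw. 0 \<le> x i \<and> x i \<le> 1"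
  using simplex
proof eventually_elim
  case (elim x)
  then show ?case using simplex_vec_le_1[of b x i] by (auto simp: simplex_vec_def)
qed

lemma AE_env_simplex: "AE \<omega> in env. \<forall>u. simplex_vec b (\<omega> u)"
  unfolding AE_all_countable
proof
  fix u
  show "AE \<omega> in env. simplex_vec b (\<omega> u)"
    using simplex by (intro AE_PiM_component) (auto simp: simplex_vec_def prob_space_axioms)
qed

lemma nn_integral_component_powr:
  assumes i: "i < b" and \<theta>: "\<theta> \<ge> 0"
  shows "(\<integral>\<^sup>+ x. ennreal (x i powr \<theta>) \<partial>Vlaw) = ennreal (moment \<theta>)"
proof -
  have i0: "0 < b" using b by simp
  have "(\<integral>\<^sup>+ x. ennreal (x i powr \<theta>) \<partial>Vlaw) = (\<integral>\<^sup>+ y. ennreal (y powr \<theta>) \<partial>distr Vlaw borel (\<lambda>x. x i))"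
    using measurable_component[OF i] by (subst nn_integral_distr) auto
  also have "\<dots> = (\<integral>\<^sup>+ y. ennreal (y powr \<theta>) \<partial>distr Vlaw borel (\<lambda>x. x 0))"
    by (simp only: ident[rule_format, OF i])
  also have "\<dots> = (\<integral>\<^sup>+ x. ennreal (x 0 powr \<theta>) \<partial>Vlaw)"
    using measurable_component[OF i0] by (subst nn_integral_distr) auto
  also have "\<dots> = ennreal (moment \<theta>)"
    unfolding moment_def
  proof (intro nn_integral_eq_integral integrable_const_bound[where B=1])
    show "AE x in Vlaw. norm (x 0 powr \<theta>) \<le> 1"
      using AE_component[OF i0] by eventually_elim (use \<theta> in \<open>auto intro: powr_le1\<close>)
  qed (use measurable_component[OF i0] in auto)
  finally show ?thesis .
qed

text \<open>The factors of \<open>path_weight\<close> belong to distinct vertices, the strict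
  prefixes of \<open>t\<close>, and are therefore independent; each has the common law of the
  components.\<close>

lemma nn_integral_path_weight_powr:
  assumes t: "set t \<subseteq> {..<b}" and \<theta>: "\<theta> \<ge> 0"
  shows "(\<integral>\<^sup>+ \<omega>. ennreal (path_weight \<omega> t powr \<theta>) \<partial>env) = ennreal (moment \<theta> ^ length t)"
proof -
  interpret P: product_prob_space "\<lambda>_ :: nat list. Vlaw" UNIV
    by unfold_locales
  have tj: "t ! j < b" if "j < length t" for j using t that nth_mem by fastforce
  define J where "J = (\<lambda>j. take j t) ` {..<length t}"
  have inj: "inj_on (\<lambda>j. take j t) {..<length t}"
    by (rule inj_onI) (auto dest!: arg_cong[of _ _ length])
  have "(\<integral>\<^sup>+ \<omega>. ennreal (path_weight \<omega> t powr \<theta>) \<partial>env) =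
      (\<integral>\<^sup>+ \<omega>. (\<Prod>u\<in>J. ennreal (\<omega> u (t ! length u) powr \<theta>)) \<partial>env)"
  proof (intro nn_integral_cong_AE)
    show "AE \<omega> in env. ennreal (path_weight \<omega> t powr \<theta>) = (\<Prod>u\<in>J. ennreal (\<omega> u (t ! length u) powr \<theta>))"
      using AE_env_simplex
    proof eventually_elim
      case (elim \<omega>)
      have "path_weight \<omega> t powr \<theta> = (\<Prod>j<length t. \<omega> (take j t) (t ! j) powr \<theta>)"
        unfolding path_weight_def using elim tj
        by (subst prod_powr_distrib) (auto simp: simplex_vec_def)
      also have "ennreal \<dots> = (\<Prod>j<length t. ennreal (\<omega> (take j t) (t ! j) powr \<theta>))"
        by (simp add: prod_ennreal)
      also have "\<dots> = (\<Prod>u\<in>J. ennreal (\<omega> u (t ! length u) powr \<theta>))"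
        unfolding J_def prod.reindex[OF inj] by (intro prod.cong) (auto simp: min_def)
      finally show ?case .
    qed
  qed
  also have "\<dots> = (\<Prod>u\<in>J. \<integral>\<^sup>+ x. ennreal (x (t ! length u) powr \<theta>) \<partial>Vlaw)"
    using measurable_component tj unfolding J_def
    by (intro P.nn_integral_PiM_prod) (auto simp: min_def intro!: measurable_compose[OF _ measurable_ennreal] powr_real_measurable)
  also have "\<dots> = (\<Prod>u\<in>J. ennreal (moment \<theta>))"
    using tj \<theta> by (intro prod.cong nn_integral_component_powr) (auto simp: J_def min_def)
  also have "\<dots> = ennreal (moment \<theta>) ^ length t"
    by (simp add: J_def card_image[OF inj])
  also have "\<dots> = ennreal (moment \<theta> ^ length t)"
    by (simp add: ennreal_power moment_def integral_nonneg_AE)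
  finally show ?thesis .
qed

lemma measurable_path_weight:
  assumes t: "set t \<subseteq> {..<b}"
  shows "(\<lambda>\<omega>. path_weight \<omega> t) \<in> borel_measurable env"
  unfolding path_weight_def
proof (intro borel_measurable_prod)
  fix j assume "j \<in> {..<length t}"
  then have "t ! j < b" using t nth_mem by fastforce
  then show "(\<lambda>\<omega>. \<omega> (take j t) (t ! j)) \<in> borel_measurable env"
    by (intro measurable_compose[OF measurable_component_singleton, where g="\<lambda>x. x (t ! j)"]
        measurable_component) auto
qed

text \<open>The exponent \<open>\<theta>\<close> may be chosen for each depth separately, which allows values below \<open>1\<close> at
  small depths and above \<open>1\<close> at large ones.\<close>

lemma expected_vertices_le:
  fixes s s0 s1 n :: nat and \<theta> f :: "nat \<Rightarrow> real"
  assumes params: "s \<ge> 1" "s0 \<le> s" "b * s1 \<le> s + 1 - s0" and n: "n > 0"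
    and \<theta>: "\<And>d. 0 \<le> \<theta> d" "\<And>d. \<theta> d \<le> 2"
    and f: "\<And>d. 0 \<le> f d" "f sums S"
    and small: "\<And>d. P d \<Longrightarrow> d < 2 \<Longrightarrow> real b ^ d \<le> f d"
    and large: "\<And>d. P d \<Longrightarrow> d \<ge> 2 \<Longrightarrow>
      (real b)\<^sup>2 * exp 1 * real n powr \<theta> d * (real b * moment (\<theta> d)) ^ (d - 2) \<le> f d"
  shows "(\<integral>\<^sup>+ \<omega>. (\<integral>\<^sup>+ C. ennreal (real (card {v \<in> tree_vertices C. P (length v)}))
      \<partial>measure_spmf (split_config b s s0 s1 \<omega> n)) \<partial>env) \<le> ennreal S"
proof -
  \<comment> \<open>\<open>take (d - 2) v\<close> is the grandparent of \<open>v\<close>. Depths 0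
    and 1 have none, and the trivial bound 1 is used there.\<close>
  define h :: "nat \<Rightarrow> nat list \<Rightarrow> (nat list \<Rightarrow> nat \<Rightarrow> real) \<Rightarrow> ennreal" where
    "h d v \<omega> = (if \<not> P d then 0 else if d < 2 then 1
       else ennreal (exp 1 * (real n * path_weight \<omega> (take (d - 2) v)) powr \<theta> d))" for d v \<omega>
  have inner: "(\<integral>\<^sup>+ C. ennreal (real (card {v \<in> tree_vertices C. P (length v)}))
      \<partial>measure_spmf (split_config b s s0 s1 \<omega> n)) \<le> (\<Sum>d. \<Sum>v\<in>words b d. h d v \<omega>)"
    if simp\<omega>: "\<forall>u. simplex_vec b (\<omega> u)" for \<omega>
  proof -
    let ?M = "measure_spmf (split_config b s s0 s1 \<omega> n)"
    let ?T = "\<lambda>C. {v \<in> tree_vertices C. P (length v)}"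
    have sx: "\<And>u. simplex_vec b (\<omega> u)" using simp\<omega> by simp
    have wfAE: "AE C in ?M. wf_state b s s1 [] C"
      using AE_wf_state[where t="[]" and z=1, OF sx _ b params] by simp
    have "(\<integral>\<^sup>+ C. ennreal (real (card (?T C))) \<partial>?M) \<le>
        (\<integral>\<^sup>+ C. (\<Sum>d. \<Sum>v\<in>words b d. indicator (?T C) v) \<partial>?M)"
    proof (rule nn_integral_mono_AE)
      show "AE C in ?M. ennreal (real (card (?T C))) \<le> (\<Sum>d. \<Sum>v\<in>words b d. indicator (?T C) v)"
        using wfAE
      proof eventually_elim
        case (elim C)
        note wf = this
        have sub: "tree_vertices C \<subseteq> (\<Union>w\<in>{w. C w \<noteq> 0}. set (prefixes w))"
        proof
          fix v assume "v \<in> tree_vertices C"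
          then obtain w where "prefix v w" "C w \<noteq> 0"
            using nsub_posD[of C v] by (auto simp: tree_vertices_def)
          then show "v \<in> (\<Union>w\<in>{w. C w \<noteq> 0}. set (prefixes w))" by auto
        qed
        have "finite (tree_vertices C)"
          using wf by (intro finite_subset[OF sub]) (auto simp: wf_state_def)
        moreover have "set v \<subseteq> {..<b}" if v: "v \<in> tree_vertices C" for v
        proof -
          obtain w where "prefix v w" "C w \<noteq> 0" 
            using v nsub_posD[of C v] by (auto simp: tree_vertices_def)
          then have "set v \<subseteq> set w" "set w \<subseteq> {..<b}"
            using wf set_mono_prefix by (auto simp: wf_state_def)
          then show ?thesis by (rule order_trans)
        qed
        ultimately show "ennreal (real (card (?T C))) \<le> (\<Sum>d. \<Sum>v\<in>words b d. indicator (?T C) v)"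
          by (intro ennreal_card_words_le) auto
      qed
    qed
    also have "\<dots> = (\<Sum>d. \<Sum>v\<in>words b d. \<integral>\<^sup>+ C. indicator (?T C) v \<partial>?M)"
      by (simp add: nn_integral_suminf nn_integral_sum)
    also have "\<dots> \<le> (\<Sum>d. \<Sum>v\<in>words b d. h d v \<omega>)"
    proof (intro suminf_le sum_mono allI)
      fix d v assume v: "v \<in> words b d"
      show "(\<integral>\<^sup>+ C. indicator (?T C) v \<partial>?M) \<le> h d v \<omega>"
      proof (cases "P d")
        case False
        then show ?thesis using v by (simp add: words_def)
      next
        case True
        have "(\<integral>\<^sup>+ C. indicator (?T C) v \<partial>?M) = (\<integral>\<^sup>+ C. indicator {C. v \<in> tree_vertices C} C \<partial>?M)"
          using v True by (intro nn_integral_cong) (auto simp: words_def split: split_indicator)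
        also have "\<dots> = emeasure ?M {C. v \<in> tree_vertices C}" by simp
        also have "\<dots> \<le> h d v \<omega>"
        proof (cases "d < 2")
          case True
          then show ?thesis using \<open>P d\<close> by (simp add: h_def measure_spmf.subprob_emeasure_le_1)
        next
          case False
          define t where "t = take (d - 2) v"
          have len: "length v = Suc (Suc (d - 2))" and setv: "set v \<subseteq> {..<b}" using v False by (auto simp: words_def)
          have "length (drop (d - 2) v) = Suc (Suc 0)" using len by simp
          then obtain i j where ij: "drop (d - 2) v = [i, j]" unfolding length_Suc_conv length_0_conv by blast
          have v': "v = t @ [i, j]" using append_take_drop_id[of "d - 2" v] ij by (simp add: t_def)
          have "set t \<subseteq> {..<b}" "i < b" using setv unfolding v' by auto
          then have "measure ?M {C. t @ [i, j] \<in> tree_vertices C} \<le> exp 1 * (real n * path_weight \<omega> t) powr \<theta> d"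
            using \<theta> params b n sx by (intro measure_subtree_le) auto
          then show ?thesis using True False
            by (simp add: h_def measure_spmf.emeasure_eq_measure v'[symmetric] t_def[symmetric] ennreal_leI)
        qed
        finally show ?thesis .
      qed
    qed auto
    finally show ?thesis .
  qed
  have meas: "h d v \<in> borel_measurable env" if "v \<in> words b d" for d v
  proof -
    have "set (take (d - 2) v) \<subseteq> {..<b}" using that set_take_subset[of "d - 2" v] by (auto simp: words_def)
    from measurable_path_weight[OF this] show ?thesis unfolding h_def[abs_def] by measurable
  qed
  \<comment> \<open>The budget \<open>f d\<close> of a depth is shared equally by its
    \<open>b ^ d\<close> words.\<close>
  have int_h: "(\<integral>\<^sup>+ \<omega>. h d v \<omega> \<partial>env) \<le> ennreal (f d / real b ^ d)" if v: "v \<in> words b d" for d v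
  proof -
    interpret E: prob_space env by (intro prob_space_PiM) (rule prob_space_axioms)
    consider "\<not> P d" | "P d" "d < 2" | "P d" "d \<ge> 2" by linarith
    then show ?thesis
    proof cases
      case 1
      then show ?thesis by (simp add: h_def)
    next
      case 2
      then have "1 \<le> f d / real b ^ d" using small[OF 2] b by (simp add: le_divide_eq)
      then show ?thesis using 2 by (simp add: h_def E.emeasure_space_1)
    next
      case 3
      let ?t = "take (d - 2) v"
      have t: "set ?t \<subseteq> {..<b}" using that set_take_subset[of "d - 2" v] by (auto simp: words_def)
      have mm: "moment (\<theta> d) \<ge> 0" by (simp add: moment_def)
      have "(\<integral>\<^sup>+ \<omega>. h d v \<omega> \<partial>env) =
          (\<integral>\<^sup>+ \<omega>. ennreal (exp 1 * real n powr \<theta> d) * ennreal (path_weight \<omega> ?t powr \<theta> d) \<partial>env)"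
      proof (intro nn_integral_cong_AE)
        show "AE \<omega> in env. h d v \<omega> = ennreal (exp 1 * real n powr \<theta> d) * ennreal (path_weight \<omega> ?t powr \<theta> d)"
          using AE_env_simplex
        proof eventually_elim
          case (elim \<omega>)
          then have "path_weight \<omega> ?t \<ge> 0" using path_weight_bounds(1)[OF _ t] by blast
          then show ?case using 3 by (simp add: h_def ennreal_mult[symmetric] powr_mult mult.assoc)
        qed
      qed
      also have "\<dots> = ennreal (exp 1 * real n powr \<theta> d) * ennreal (moment (\<theta> d) ^ length ?t)"
        using measurable_path_weight[OF t] \<theta>
        by (subst nn_integral_cmult) (auto simp: nn_integral_path_weight_powr[OF t])
      also have "length ?t = d - 2" using v by (auto simp: words_def)
      also have "ennreal (exp 1 * real n powr \<theta> d) * ennreal (moment (\<theta> d) ^ (d - 2)) =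
          ennreal (exp 1 * real n powr \<theta> d * moment (\<theta> d) ^ (d - 2))"
        using mm by (simp add: ennreal_mult)
      also have "\<dots> \<le> ennreal (f d / real b ^ d)"
      proof (rule ennreal_leI)
        have "real b ^ d = (real b)\<^sup>2 * real b ^ (d - 2)" using 3(2) by (metis le_add_diff_inverse power_add)
        then show "exp 1 * real n powr \<theta> d * moment (\<theta> d) ^ (d - 2) \<le> f d / real b ^ d"
          using large[OF 3] b by (simp add: le_divide_eq power_mult_distrib mult_ac)
      qed
      finally show ?thesis .
    qed
  qed
  have "(\<integral>\<^sup>+ \<omega>. (\<integral>\<^sup>+ C. ennreal (real (card {v \<in> tree_vertices C. P (length v)}))
      \<partial>measure_spmf (split_config b s s0 s1 \<omega> n)) \<partial>env) \<le> (\<integral>\<^sup>+ \<omega>. (\<Sum>d. \<Sum>v\<in>words b d. h d v \<omega>) \<partial>env)"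
    by (intro nn_integral_mono_AE eventually_mono[OF AE_env_simplex] inner)
  also have "\<dots> = (\<Sum>d. \<Sum>v\<in>words b d. \<integral>\<^sup>+ \<omega>. h d v \<omega> \<partial>env)"
    using meas by (simp add: nn_integral_suminf nn_integral_sum)
  also have "\<dots> \<le> (\<Sum>d. ennreal (f d))"
  proof (intro suminf_le allI)
    fix d
    have "(\<Sum>v\<in>words b d. \<integral>\<^sup>+ \<omega>. h d v \<omega> \<partial>env) \<le> (\<Sum>v\<in>words b d. ennreal (f d / real b ^ d))"
      by (intro sum_mono int_h)
    also have "\<dots> = ennreal (f d)"
      using b f(1)[of d] by (simp add: card_words ennreal_of_nat_eq_real_of_nat ennreal_mult[symmetric])
    finally show "(\<Sum>v\<in>words b d. \<integral>\<^sup>+ \<omega>. h d v \<omega> \<partial>env) \<le> ennreal (f d)" .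
  qed auto
  also have "\<dots> = ennreal S" using f by (simp add: suminf_ennreal2 sums_iff)
  finally show ?thesis .
qed

end

section \<open>The drift and the moments with exponent near one\<close>

locale proper_split_law = split_law +
  assumes V_pos: "AE x in Vlaw. x 0 \<noteq> 0" and V_less_1: "AE x in Vlaw. x 0 \<noteq> 1"
begin

definition drift :: real where
  "drift = real b * (\<integral>x. - (x 0) * ln (x 0) \<partial>Vlaw)"

lemma integrable_component: "i < b \<Longrightarrow> integrable Vlaw (\<lambda>x. x i)"
  using AE_component[of i] measurable_component[of i]
  by (intro integrable_const_bound[where B=1]) (auto elim: eventually_mono)

lemma expectation_component: "real b * (\<integral>x. x 0 \<partial>Vlaw) = 1"
proof -
  have same: "(\<integral>x. x i \<partial>Vlaw) = (\<integral>x. x 0 \<partial>Vlaw)" if i: "i < b" for i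
  proof -
    have "(\<integral>x. x i \<partial>Vlaw) = (\<integral>y. y \<partial>distr Vlaw borel (\<lambda>x. x i))"
      using measurable_component[OF i] by (subst integral_distr) auto
    also have "\<dots> = (\<integral>y. y \<partial>distr Vlaw borel (\<lambda>x. x 0))"
      by (simp only: ident[rule_format, OF i])
    also have "\<dots> = (\<integral>x. x 0 \<partial>Vlaw)"
      using measurable_component[of 0] b by (subst integral_distr) auto
    finally show ?thesis .
  qed
  have "real b * (\<integral>x. x 0 \<partial>Vlaw) = (\<Sum>i<b. \<integral>x. x 0 \<partial>Vlaw)" by simp
  also have "\<dots> = (\<Sum>i<b. \<integral>x. x i \<partial>Vlaw)" by (intro sum.cong same[symmetric]) auto
  also have "\<dots> = (\<integral>x. (\<Sum>i<b. x i) \<partial>Vlaw)"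
    by (intro Bochner_Integration.integral_sum[symmetric] integrable_component) auto
  also have "\<dots> = (\<integral>x. 1 \<partial>Vlaw)"
    using simplex measurable_component
    by (intro integral_cong_AE) (auto elim: eventually_mono intro!: borel_measurable_sum)
  finally show ?thesis by (simp add: prob_space)
qed

lemma x_ln_x_bounds:
  fixes x :: real
  assumes "0 \<le> x" "x \<le> 1"
  shows "0 \<le> - x * ln x" "- x * ln x \<le> 1"
proof -
  show "0 \<le> - x * ln x"
    using assms by (cases "x = 0") (auto simp: mult_nonneg_nonpos)
  show "- x * ln x \<le> 1"
  proof (cases "x = 0")
    case False
    with assms have "x > 0" by simp
    then have "- ln x \<le> 1 / x - 1" using ln_le_minus_one[of "1 / x"] by (simp add: ln_div)
    then have "x * (- ln x) \<le> x * (1 / x - 1)" using \<open>x > 0\<close> by (intro mult_left_mono) auto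
    then show ?thesis using \<open>x > 0\<close> by (simp add: algebra_simps)
  qed simp
qed

lemma measurable_x_ln_x: "(\<lambda>x. - (x 0) * ln (x 0)) \<in> borel_measurable Vlaw"
  using measurable_component[of 0] b
  by (intro borel_measurable_times borel_measurable_uminus borel_measurable_ln) auto

lemma integrable_x_ln_x: "integrable Vlaw (\<lambda>x. - (x 0) * ln (x 0))"
proof (rule integrable_const_bound[where B=1])
  have "0 < b" using b by simp
  from AE_component[OF this] show "AE x in Vlaw. norm (- (x 0) * ln (x 0)) \<le> 1"
  proof eventually_elim
    case (elim x)
    then show ?case using x_ln_x_bounds[of "x 0"] by auto
  qed
qed (rule measurable_x_ln_x)

text \<open>The component lies strictly between 0 and 1 almost surely, so the integrand is strictly
  positive almost everywhere and its integral cannot vanish.\<close>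

lemma drift_pos: "drift > 0"
proof -
  have "0 < b" using b by simp
  from AE_component[OF this] V_pos V_less_1
  have pos: "AE x in Vlaw. 0 < - (x 0) * ln (x 0)"
  proof eventually_elim
    case (elim x)
    then have "0 < x 0" "x 0 < 1" by auto
    then show ?case by (simp add: mult_pos_neg)
  qed
  have "0 \<le> (\<integral>x. - (x 0) * ln (x 0) \<partial>Vlaw)"
    using pos by (intro integral_nonneg_AE) (auto elim: eventually_mono)
  moreover have "(\<integral>x. - (x 0) * ln (x 0) \<partial>Vlaw) \<noteq> 0"
  proof
    assume "(\<integral>x. - (x 0) * ln (x 0) \<partial>Vlaw) = 0"
    then have "AE x in Vlaw. - (x 0) * ln (x 0) = 0"
      using pos by (subst (asm) integral_nonneg_eq_0_iff_AE[OF integrable_x_ln_x])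
        (auto elim: eventually_mono)
    with pos have "AE x in Vlaw. False" by eventually_elim auto
    then show False by simp
  qed
  ultimately have "(\<integral>x. - (x 0) * ln (x 0) \<partial>Vlaw) > 0" by linarith
  with b show ?thesis unfolding drift_def by (intro mult_pos_pos) auto
qed

lemma moment_nonneg: "0 \<le> moment \<theta>"
  by (simp add: moment_def)

text \<open>Integrating \<open>powr_le_quadratic\<close> gives this with 1 + w in place of exp w,
  since b E V = 1. Both signs of \<delta> are covered: negative ones serve the small depths,
  positive ones the large.\<close>

lemma moment_le_exp:
  assumes \<delta>: "\<bar>\<delta>\<bar> \<le> 1 / 2"
  shows "real b * moment (1 + \<delta>) \<le> exp (- drift * \<delta> + 4 * real b * \<delta>\<^sup>2)"
proof -
  have b0: "0 < b" using b by simp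
  have int: "integrable Vlaw (\<lambda>x. x 0 - \<delta> * (- (x 0) * ln (x 0)) + 4 * \<delta>\<^sup>2)"
    by (intro Bochner_Integration.integrable_add Bochner_Integration.integrable_diff
        integrable_mult_right integrable_component[OF b0] integrable_x_ln_x integrable_const)
  have "moment (1 + \<delta>) \<le> (\<integral>x. x 0 - \<delta> * (- (x 0) * ln (x 0)) + 4 * \<delta>\<^sup>2 \<partial>Vlaw)"
    unfolding moment_def
  proof (rule integral_mono_AE[OF _ int])
    show "integrable Vlaw (\<lambda>x. x 0 powr (1 + \<delta>))"
    proof (rule integrable_const_bound[where B=1])
      show "AE x in Vlaw. norm (x 0 powr (1 + \<delta>)) \<le> 1"
        using AE_component[OF b0] by eventually_elim (use \<delta> in \<open>auto intro: powr_le1\<close>)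
    qed (use measurable_component[OF b0] in auto)
    show "AE x in Vlaw. x 0 powr (1 + \<delta>) \<le> x 0 - \<delta> * (- (x 0) * ln (x 0)) + 4 * \<delta>\<^sup>2"
      using AE_component[OF b0] by eventually_elim (use \<delta> in \<open>auto intro: powr_le_quadratic[simplified]\<close>)
  qed
  also have "\<dots> = (\<integral>x. x 0 \<partial>Vlaw) - \<delta> * (\<integral>x. - (x 0) * ln (x 0) \<partial>Vlaw) + 4 * \<delta>\<^sup>2"
    using integrable_component[OF b0] integrable_x_ln_x
    by (subst Bochner_Integration.integral_add Bochner_Integration.integral_diff
        integral_mult_right_zero; (simp add: prob_space)?)+
  finally have "real b * moment (1 + \<delta>) \<le> real b * \<dots>"
    by (intro mult_left_mono) auto
  also have "\<dots> = 1 + (- drift * \<delta> + 4 * real b * \<delta>\<^sup>2)"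
    using expectation_component by (simp add: drift_def algebra_simps)
  also have "\<dots> \<le> exp (- drift * \<delta> + 4 * real b * \<delta>\<^sup>2)" by (rule exp_ge_add_one_self)
  finally show ?thesis .
qed

lemma sums_two_levels: "(\<lambda>d. if d < 2 then real b ^ d else 0) sums (1 + real b)"
  using sums_If_finite_set[of "{..<2}" "\<lambda>d. real b ^ d"] by (simp add: numeral_2_eq_2)

text \<open>The decay up to depth \<open>h\<close> is split off, leaving a geometric series that
  starts at \<open>h\<close>. The factor \<open>exp (2 * \<rho>)\<close> pays for the two levels
  between a vertex and its grandparent.\<close>

lemma moment_power_le:
  assumes \<delta>: "0 < \<delta>" "\<delta> \<le> 1 / 2" and n: "n > 0"
    and d: "d \<ge> 2" and h: "h \<le> d"
    and \<rho>: "\<rho> = drift * \<delta> - 4 * real b * \<delta>\<^sup>2"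
  shows "(real b)\<^sup>2 * exp 1 * real n powr (1 + \<delta>) * (real b * moment (1 + \<delta>)) ^ (d - 2) \<le>
    (real b)\<^sup>2 * exp 1 * exp (2 * \<rho>) * exp ((1 + \<delta>) * ln n - \<rho> * real h) * exp (- \<rho>) ^ (d - h)"
proof -
  have "(real b * moment (1 + \<delta>)) ^ (d - 2) \<le> exp (- \<rho>) ^ (d - 2)"
    using moment_le_exp[of \<delta>] \<delta> moment_nonneg by (intro power_mono) (auto simp: \<rho>)
  also have "\<dots> = exp (2 * \<rho>) * exp (- \<rho> * real h) * exp (- \<rho>) ^ (d - h)"
    using d h by (simp add: exp_of_nat_mult[symmetric] exp_add[symmetric] of_nat_diff algebra_simps)
  finally have "real n powr (1 + \<delta>) * (real b * moment (1 + \<delta>)) ^ (d - 2) \<le>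
      exp ((1 + \<delta>) * ln n) * (exp (2 * \<rho>) * exp (- \<rho> * real h) * exp (- \<rho>) ^ (d - h))"
    using n by (intro mult_mono) (auto simp: powr_def moment_nonneg)
  also have "\<dots> = exp (2 * \<rho>) * exp ((1 + \<delta>) * ln n - \<rho> * real h) * exp (- \<rho>) ^ (d - h)"
    by (simp add: exp_diff exp_minus field_simps)
  finally have "(real b)\<^sup>2 * exp 1 * (real n powr (1 + \<delta>) * (real b * moment (1 + \<delta>)) ^ (d - 2)) \<le>
      (real b)\<^sup>2 * exp 1 * (exp (2 * \<rho>) * exp ((1 + \<delta>) * ln n - \<rho> * real h) * exp (- \<rho>) ^ (d - h))"
    by (intro mult_left_mono) auto
  then show ?thesis by (simp only: mult.assoc)
qed

section \<open>Expected numbers of vertices and of bad vertices\<close>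

context
  fixes s s0 s1 :: nat
  assumes params: "s \<ge> 1" "s0 \<le> s" "b * s1 \<le> s + 1 - s0"
begin

abbreviation expected_vertices :: "nat \<Rightarrow> (nat \<Rightarrow> bool) \<Rightarrow> ennreal" where
  "expected_vertices n P \<equiv> (\<integral>\<^sup>+ \<omega>. (\<integral>\<^sup>+ C. ennreal (real (card {v \<in> tree_vertices C. P (length v)}))
      \<partial>measure_spmf (split_config b s s0 s1 \<omega> n)) \<partial>env)"

text \<open>Meant for n = 2, where ln n < 1 violates the assumption \<open>L\<close> \<ge> 1 of
  \<open>deviation\<close>; a fixed \<delta> with positive rate gives finiteness.\<close>

lemma expected_vertices_finite:
  assumes n: "n > 0"
  shows "\<exists>S. expected_vertices n P \<le> ennreal S"
proof -
  define \<delta> where "\<delta> = min (1 / 2) (drift / (8 * real b))"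
  define \<rho> where "\<rho> = drift * \<delta> - 4 * real b * \<delta>\<^sup>2"
  have \<delta>: "0 < \<delta>" "\<delta> \<le> 1 / 2" using drift_pos b by (auto simp: \<delta>_def)
  have "4 * real b * \<delta> \<le> 4 * real b * (drift / (8 * real b))"
    by (intro mult_left_mono) (auto simp: \<delta>_def)
  also have "\<dots> = drift / 2" using b by simp
  finally have "4 * real b * \<delta> * \<delta> \<le> drift / 2 * \<delta>" using \<delta> by (intro mult_right_mono) auto
  then have "\<rho> \<ge> drift * \<delta> / 2" by (simp add: \<rho>_def power2_eq_square mult_ac)
  moreover have "drift * \<delta> / 2 > 0" using drift_pos \<delta> by simp
  ultimately have \<rho>: "\<rho> > 0" by linarith
  define Y where "Y = (real b)\<^sup>2 * exp 1 * exp (2 * \<rho>) * exp ((1 + \<delta>) * ln n - \<rho> * real 0)"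
  have Y: "Y \<ge> 0" by (simp add: Y_def)
  define f where "f d = (if d < 2 then real b ^ d else 0) + (if 0 \<le> d then Y * exp (- \<rho>) ^ (d - 0) else 0)" for d :: nat
  have "expected_vertices n P \<le> ennreal ((1 + real b) + Y / (1 - exp (- \<rho>)))"
  proof (rule expected_vertices_le[where \<theta>="\<lambda>_. 1 + \<delta>" and f=f, OF params n])
    show "f sums ((1 + real b) + Y / (1 - exp (- \<rho>)))"
      unfolding f_def using \<rho> by (intro sums_add sums_two_levels sums_geometric_from) auto
    show "(real b)\<^sup>2 * exp 1 * real n powr (1 + \<delta>) * (real b * moment (1 + \<delta>)) ^ (d - 2) \<le> f d"
      if "d \<ge> 2" for d
      using moment_power_le[OF \<delta> n that le0 \<rho>_def] that by (simp add: f_def Y_def)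
  qed (use \<delta> Y in \<open>auto simp: f_def\<close>)
  then show ?thesis by blast
qed

lemma expected_bad_vertices_le:
  assumes \<epsilon>: "\<epsilon> > 0"
  obtains A \<kappa> e where "A \<ge> 0" "\<kappa> > 0" "e > 0"
    "\<And>n. n \<ge> 3 \<Longrightarrow> expected_vertices n (\<lambda>d. \<not> good_depth drift \<epsilon> n d) \<le>
      ennreal (1 + real b + A * real n * ln n * exp (- \<kappa> * ln n powr e))"
proof -
  define c where "c = 4 * real b"
  define \<mu> where "\<mu> = drift"
  have c: "c > 0" and \<mu>: "\<mu> > 0" using b drift_pos by (auto simp: c_def \<mu>_def)
  define \<eta> where "\<eta> = min (1 / 2) (min (\<mu> / (2 * c)) (\<mu>\<^sup>2 / (4 * c)))"
  have \<eta>: "\<eta> > 0" "\<eta> \<le> 1 / 2" "\<eta> \<le> \<mu> / (2 * c)" "\<eta> \<le> \<mu>\<^sup>2 / (4 * c)"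
    using c \<mu> by (auto simp: \<eta>_def)
  define \<kappa> where "\<kappa> = \<mu> * \<eta> / 4"
  have \<kappa>: "\<kappa> > 0" using \<mu> \<eta> by (simp add: \<kappa>_def)
  \<comment> \<open>The summand \<open>1 / \<mu> + 1\<close> bounds the number of small depths
    divided by \<open>L\<close>; the last one is the geometric series by \<open>rate_bound\<close>,
    with \<open>exp (2 * \<rho>)\<close> \<le> \<open>exp (2 * \<mu>)\<close>.\<close>
  define A where "A = (real b)\<^sup>2 * exp 1 * (1 / \<mu> + 1 + exp (2 * \<mu>) * (1 + 2 / (\<mu> * \<eta>)))"
  have A: "A \<ge> 0" using \<mu> \<eta> by (simp add: A_def add_nonneg_nonneg)
  define e where "e = 2 * min \<epsilon> (1 / 4)"
  have e: "e > 0" using \<epsilon> by (simp add: e_def)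
  have "expected_vertices n (\<lambda>d. \<not> good_depth drift \<epsilon> n d) \<le>
      ennreal (1 + real b + A * real n * ln n * exp (- \<kappa> * ln n powr e))" if n: "n \<ge> 3" for n
  proof -
    define L where "L = ln (real n)"
    \<comment> \<open>This is where \<open>n\<close> \<ge> 3 enters: it ensures ln n \<ge>
      1.\<close>
    have "exp 1 \<le> real n" using exp_le n by linarith
    then have L: "L \<ge> 1" using n by (simp add: L_def ln_ge_iff)
    have n0: "n > 0" using n by simp
    have nL: "real n = exp L" using n by (simp add: L_def)
    interpret D: deviation \<mu> c \<eta> \<epsilon> L
      by unfold_locales (fact \<mu> c \<epsilon> L \<eta>)+
    have q: "D.q = L powr e" by (simp add: D.q_def D.\<epsilon>'_def e_def)
    define lo where "lo = L / \<mu> - L powr (1 / 2 + \<epsilon>)"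
    define hi where "hi = L / \<mu> + L powr (1 / 2 + \<epsilon>)"
    have bad: "\<not> good_depth drift \<epsilon> n d \<longleftrightarrow> real d < lo \<or> hi < real d" for d
      by (auto simp: good_depth_def lo_def hi_def L_def \<mu>_def)
    have lohi: "lo \<le> L / \<mu>" "lo \<le> hi" by (auto simp: lo_def hi_def)
    define E where "E = exp (L - \<kappa> * D.q)"
    define N where "N = nat \<lceil>L / \<mu>\<rceil>"
    have N: "real N \<le> L / \<mu> + 1" "\<And>d. real d < L / \<mu> \<Longrightarrow> d < N"
    proof -
      have "L / \<mu> \<ge> 0" using L \<mu> by simp
      then show "real N \<le> L / \<mu> + 1" "\<And>d. real d < L / \<mu> \<Longrightarrow> d < N"
        unfolding N_def by linarith+
    qed
    define h where "h = nat \<lceil>hi\<rceil>"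
    have h: "hi \<le> real h" "\<And>d. hi < real d \<Longrightarrow> h \<le> d" unfolding h_def by linarith+
    define X where "X = (real b)\<^sup>2 * exp 1 * E"
    define Y where "Y = (real b)\<^sup>2 * exp 1 * exp (2 * D.\<rho>) * exp ((1 + D.\<delta>) * ln n - D.\<rho> * real h)"
    \<comment> \<open>The three nonnegative terms are meant for the depths 0 and 1, the depths below
      the window and those above it; a bad depth has to be dominated by only one of them.\<close>
    define f where "f d = (if d < 2 then real b ^ d else 0) + ((if d \<in> {..<N} then X else 0) +
      (if h \<le> d then Y * exp (- D.\<rho>) ^ (d - h) else 0))" for d
    define \<theta> where "\<theta> d = (if real d < lo then 1 - D.\<delta> else 1 + D.\<delta>)" for d :: nat
    have \<delta>: "0 < D.\<delta>" "D.\<delta> \<le> 1 / 2" using D.\<delta>_pos D.\<delta>_le \<eta> by auto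
    have X: "X \<ge> 0" and Y: "Y \<ge> 0" by (auto simp: X_def Y_def E_def)
    have f_ge: "f d \<ge> 0" for d using X Y by (simp add: f_def)
    have \<rho>: "D.\<rho> = drift * D.\<delta> - 4 * real b * D.\<delta>\<^sup>2" 
      unfolding D.\<rho>_def by (simp add: \<mu>_def c_def)
    have "expected_vertices n (\<lambda>d. \<not> good_depth drift \<epsilon> n d) \<le>
        ennreal (1 + real b + (real N * X + Y / (1 - exp (- D.\<rho>))))"
    proof (rule expected_vertices_le[where \<theta>=\<theta> and f=f, OF params n0])
      show "f sums (1 + real b + (real N * X + Y / (1 - exp (- D.\<rho>))))"
        unfolding f_def using D.\<rho>_pos sums_If_finite_set[of "{..<N}" "\<lambda>_. X"]
        by (intro sums_add sums_two_levels sums_geometric_from) auto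
    next
      fix d :: nat assume P: "\<not> good_depth drift \<epsilon> n d" and d: "d \<ge> 2"
      show "(real b)\<^sup>2 * exp 1 * real n powr \<theta> d * (real b * moment (\<theta> d)) ^ (d - 2) \<le> f d"
      proof (cases "real d < lo")
        case True
        let ?m = "\<mu> * D.\<delta> + c * D.\<delta>\<^sup>2"
        have m: "?m \<ge> 0" using \<mu> c \<delta> by simp
        have "(real b * moment (1 - D.\<delta>)) ^ (d - 2) \<le> exp ?m ^ (d - 2)"
          using moment_le_exp[of "- D.\<delta>"] \<delta> moment_nonneg
          by (intro power_mono) (auto simp: \<mu>_def c_def)
        also have "\<dots> \<le> exp ?m ^ d" using m by (intro power_increasing) auto
        also have "\<dots> = exp (real d * ?m)" by (simp only: exp_of_nat_mult)
        finally have "real n powr (1 - D.\<delta>) * (real b * moment (1 - D.\<delta>)) ^ (d - 2) \<le>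
            exp ((1 - D.\<delta>) * L) * exp (real d * ?m)"
          using n by (intro mult_mono) (auto simp: powr_def L_def moment_nonneg)
        also have "\<dots> \<le> E"
          unfolding exp_add[symmetric] E_def \<kappa>_def
          using D.low_exponent[of "real d"] True by (simp add: lo_def)
        finally have "(real b)\<^sup>2 * exp 1 * (real n powr (1 - D.\<delta>) * (real b * moment (1 - D.\<delta>)) ^ (d - 2)) \<le> X"
          unfolding X_def by (intro mult_left_mono) auto
        moreover have "d < N" using True lohi N(2) by simp
        then have "X \<le> f d" using d Y by (simp add: f_def)
        ultimately show ?thesis using True by (simp add: \<theta>_def mult.assoc)
      next
        case False
        then have hd: "h \<le> d" using P h(2) by (simp add: bad)
        show ?thesis
          using moment_power_le[OF \<delta> n0 d hd \<rho>] False d hd X by (simp add: f_def \<theta>_def Y_def)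
      qed
    next
      show "real b ^ d \<le> f d" if "d < 2" for d using that X Y by (simp add: f_def)
      show "0 \<le> \<theta> d" "\<theta> d \<le> 2" for d using \<delta> by (auto simp: \<theta>_def)
    qed (fact f_ge)
    also have "1 + real b + (real N * X + Y / (1 - exp (- D.\<rho>))) \<le>
        1 + real b + A * real n * ln n * exp (- \<kappa> * ln n powr e)"
    proof -
      have "real N * X \<le> (1 / \<mu> + 1) * L * X"
      proof (intro mult_right_mono X)
        show "real N \<le> (1 / \<mu> + 1) * L" using N(1) L by (simp add: distrib_right)
      qed
      moreover have "Y / (1 - exp (- D.\<rho>)) \<le> (real b)\<^sup>2 * exp 1 * exp (2 * \<mu>) * E * ((1 + 2 / (\<mu> * \<eta>)) * L)"
      proof -
        have "exp ((1 + D.\<delta>) * ln n - D.\<rho> * real h) \<le> E"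
          using D.high_exponent[of "real h"] h(1) by (simp add: E_def \<kappa>_def hi_def L_def)
        then have "Y \<le> (real b)\<^sup>2 * exp 1 * exp (2 * \<mu>) * E"
          unfolding Y_def using D.\<rho>_le by (intro mult_mono) auto
        then have "Y * (1 / (1 - exp (- D.\<rho>))) \<le>
            (real b)\<^sup>2 * exp 1 * exp (2 * \<mu>) * E * ((1 + 2 / (\<mu> * \<eta>)) * L)"
          using D.\<rho>_pos by (intro mult_mono D.rate_bound) (auto simp: E_def)
        then show ?thesis by simp
      qed
      ultimately have "real N * X + Y / (1 - exp (- D.\<rho>)) \<le> (1 / \<mu> + 1) * L * X +
          (real b)\<^sup>2 * exp 1 * exp (2 * \<mu>) * E * ((1 + 2 / (\<mu> * \<eta>)) * L)" by linarith
      also have "\<dots> = A * L * E" by (simp add: A_def X_def algebra_simps)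
      also have "E = real n * exp (- \<kappa> * L powr e)" by (simp add: E_def q nL exp_diff exp_minus field_simps)
      finally show ?thesis by (simp add: L_def mult_ac)
    qed
    finally show ?thesis by (simp add: ennreal_leI)
  qed
  with A \<kappa> e show thesis by (rule that)
qed

lemma expected_bad_vertices:
  assumes \<epsilon>: "\<epsilon> > 0" and k: "k > (0 :: real)"
  shows "\<exists>K::real. \<forall>n\<ge>2. expected_vertices n (\<lambda>d. \<not> good_depth drift \<epsilon> n d) \<le>
    ennreal (K * real n / ln (real n) powr k)"
proof -
  obtain A \<kappa> e where A: "A \<ge> 0" and \<kappa>: "\<kappa> > 0" and e: "e > 0"
    and bound: "\<And>n. n \<ge> 3 \<Longrightarrow> expected_vertices n (\<lambda>d. \<not> good_depth drift \<epsilon> n d) \<le>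
      ennreal (1 + real b + A * real n * ln n * exp (- \<kappa> * ln n powr e))"
    by (rule expected_bad_vertices_le[OF \<epsilon>]) (rule that)
  obtain S where S: "expected_vertices 2 (\<lambda>d. \<not> good_depth drift \<epsilon> 2 d) \<le> ennreal S"
    using expected_vertices_finite[of 2 "\<lambda>d. \<not> good_depth drift \<epsilon> 2 d"] by auto
  \<comment> \<open>The first summand absorbs the constant \<open>1 + real b\<close> through L^k
    \<le> k^k exp L = k^k n. In the second, the power is \<open>k + 1\<close> because of the extra
    factor ln n.\<close>
  define K1 where "K1 = (1 + real b) * k powr k + A * ((k + 1) / e / \<kappa>) powr ((k + 1) / e)"
  \<comment> \<open>The second entry of the maximum settles n = 2.\<close>
  define K where "K = max K1 (S * ln 2 powr k / 2)"
  have "expected_vertices n (\<lambda>d. \<not> good_depth drift \<epsilon> n d) \<le> ennreal (K * real n / ln (real n) powr k)"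
    if n: "n \<ge> 2" for n
  proof (cases "n = 2")
    case True
    have "S = (S * ln 2 powr k / 2) * 2 / ln 2 powr k" by simp
    also have "\<dots> \<le> K * 2 / ln 2 powr k" by (intro divide_right_mono mult_right_mono) (auto simp: K_def)
    finally have "ennreal S \<le> ennreal (K * 2 / ln 2 powr k)" by (rule ennreal_leI)
    with S have "expected_vertices 2 (\<lambda>d. \<not> good_depth drift \<epsilon> 2 d) \<le> ennreal (K * 2 / ln 2 powr k)"
      by (rule order_trans)
    then show ?thesis unfolding True by simp
  next
    case False
    with n have n3: "n \<ge> 3" by simp
    define L where "L = ln (real n)"
    have L: "L > 0" using n by (simp add: L_def)
    have nL: "real n = exp L" using n by (simp add: L_def)
    have "(1 + real b) * L powr k \<le> (1 + real b) * (k powr k * real n)"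
      using powr_le_exp[of k 1 L] k L by (intro mult_left_mono) (auto simp: nL)
    moreover have "A * real n * (L * exp (- \<kappa> * L powr e) * L powr k) \<le>
        A * real n * ((k + 1) / e / \<kappa>) powr ((k + 1) / e)"
    proof (intro mult_left_mono)
      have "L * exp (- \<kappa> * L powr e) * L powr k = L powr (k + 1) * exp (- \<kappa> * L powr e)"
        using L by (simp add: powr_add mult_ac)
      also have "\<dots> \<le> ((k + 1) / e / \<kappa>) powr ((k + 1) / e)"
        using k \<kappa> e L by (intro powr_mult_exp_le) auto
      finally show "L * exp (- \<kappa> * L powr e) * L powr k \<le> ((k + 1) / e / \<kappa>) powr ((k + 1) / e)" .
    qed (use A in auto)
    ultimately have "(1 + real b + A * real n * L * exp (- \<kappa> * L powr e)) * L powr k \<le> K1 * real n"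
      by (simp add: K1_def algebra_simps)
    also have "\<dots> \<le> K * real n" by (intro mult_right_mono) (auto simp: K_def)
    finally have "1 + real b + A * real n * L * exp (- \<kappa> * L powr e) \<le> K * real n / L powr k"
      using L by (simp add: le_divide_eq)
    then show ?thesis
      unfolding L_def by (intro order_trans[OF bound[OF n3] ennreal_leI])
  qed
  then show ?thesis by blast
qed

end

end

theorem theorem2:
  fixes b s s0 s1 :: nat and Vlaw :: "(nat \<Rightarrow> real) measure" and \<epsilon> :: real
  assumes b: "b \<ge> 2" and s: "s \<ge> 1" and s0: "s0 \<le> s" and s1: "b * s1 \<le> s + 1 - s0"
    and prob: "prob_space Vlaw"
    and sets_V: "sets Vlaw = sets (PiM {..<b} (\<lambda>_. borel))"
    and simplex: "AE x in Vlaw. (\<forall>i<b. 0 \<le> x i) \<and> (\<Sum>i<b. x i) = 1"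
    and ident: "\<forall>i<b. distr Vlaw borel (\<lambda>x. x i) = distr Vlaw borel (\<lambda>x. x 0)"
    and A1_0: "emeasure Vlaw {x \<in> space Vlaw. x 0 = 0} = 0"
    and A1_1: "emeasure Vlaw {x \<in> space Vlaw. x 0 = 1} = 0"
    and A1_nonlattice: "\<not> lattice_rv Vlaw (\<lambda>x. - ln (x 0))"
    and eps: "\<epsilon> > 0"
  shows "\<forall>k::real > 0. \<exists>K::real. \<forall>n::nat \<ge> 2.
     (\<integral>\<^sup>+ \<omega>. (\<integral>\<^sup>+ C. ennreal (real (bad_count
                   (real b * (\<integral>x. - (x 0) * ln (x 0) \<partial>Vlaw)) \<epsilon> n C))
               \<partial>measure_spmf (split_config b s s0 s1 \<omega> n))
        \<partial>(PiM (UNIV :: nat list set) (\<lambda>_. Vlaw)))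
     \<le> ennreal (K * real n / ln (real n) powr k)"
proof -
  interpret prob_space Vlaw by (fact prob)
  interpret V: split_law Vlaw b
    by unfold_locales (fact b sets_V simplex ident)+
  have meas: "(\<lambda>x. x 0) \<in> borel_measurable Vlaw" using V.measurable_component[of 0] b by simp
  have sets: "{x \<in> space Vlaw. x 0 = a} \<in> sets Vlaw" for a using meas by simp
  interpret V: proper_split_law Vlaw b
  proof
    show "AE x in Vlaw. x 0 \<noteq> 0"
      by (subst AE_iff_measurable[OF sets[of 0]]) (use A1_0 in auto)
    show "AE x in Vlaw. x 0 \<noteq> 1"
      by (subst AE_iff_measurable[OF sets[of 1]]) (use A1_1 in auto)
  qed
  show ?thesis
    unfolding bad_count_def V.drift_def[symmetric]
    by (intro allI impI V.expected_bad_vertices[OF s s0 s1 eps])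
qed

end
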